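(* For every even integer $m\ge 6$, the Route E direction assignment defined below is a coloring of $D_3(m)$ (each $f_c$ is a permutation of $V$), and each of $f_0,f_1,f_2$ is a single directed cycle through all $m^3$ vertices; hence the three color classes decompose the arcs of $D_3(m)$ into three directed Hamilton cycles.
   Context: $V=(\mathbb Z_m)^3$ with points $v=(i,j,k)$; $D_3(m)$ is the digraph on $V$ with arcs $v\to v+(1,0,0)$, $v\to v+(0,1,0)$, $v\to v+(0,0,1)$ (mod $m$); "direction $0,1,2$" means adding $(1,0,0),(0,1,0),(0,0,1)$ respectively. $S(v)=i+j+k\pmod m$. The Route E direction assignment gives each vertex a triple $(d_0(v),d_1(v),d_2(v))$, a permutation of $(0,1,2)$, and $f_c(v)=v+(\text{direction }d_c(v))$. Rules (coordinates mod $m$, integer ranges refer to representatives in $\{0,\dots,m-1\}$): if $S\notin\{0,1,2\}$, triple $(0,1,2)$. If $S=1$: $(1,0,2)$ if $i=0$, $(2,0,1)$ if $i\ne0$. If $S=2$: $(2,1,0)$ if $j=0$, $(0,1,2)$ if $j\ne0$. If $S=0$ and $m\equiv0,2\pmod6$: $(1,0,2)$ on $X_{102}=\{(0,0,0)\}\cup\{(i,1,m-1-i):1\le i\le m-3\}\cup\{(m-1,2,m-1)\}$; $(0,2,1)$ on $X_{021}=\{(0,1,m-1)\}\cup\{(i,m-i,0):1\le i\le m-3\}\cup\{(m-1,0,1)\}$; $(2,1,0)$ on $X_{210}=\{(0,j,m-j):2\le j\le m-1\}\cup\{(1,0,m-1)\}$; $(0,1,2)$ at $(m-2,1,1)$;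 $(2,0,1)$ at $(m-2,2,0)$; $(1,2,0)$ otherwise. If $S=0$ and $m\equiv4\pmod6$: $(1,0,2)$ on $Y_{102}=\{(0,0,0)\}\cup\{(i,1,m-1-i):2\le i\le m-3\}\cup\{(m-1,2,m-1)\}$; $(0,2,1)$ on $Y_{021}=\{(0,1,m-1)\}\cup\{(i,m-i,0):2\le i\le m-3\}\cup\{(m-1,0,1)\}$; $(2,1,0)$ on $Y_{210}=\{(0,j,m-j):2\le j\le m-1\}\cup\{(1,0,m-1)\}\cup\{(1,j,m-1-j):2\le j\le m-2\}\cup\{(2,0,m-2),(2,m-1,m-1)\}$; $(0,1,2)$ at $(1,1,m-2)$ and $(m-2,1,1)$; $(2,0,1)$ at $(1,m-1,0)$ and $(m-2,2,0)$; $(1,2,0)$ otherwise. *)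

theory Defs
  imports
    "Graph_Theory.Graph_Theory"
    "HOL-Combinatorics.Orbits"
    "HOL-Library.Disjoint_Sets"
begin

text \<open>Points of \<open>(\<int>/m)\<^sup>3\<close> are triples of representatives in \<open>{0,\<dots>,m-1}\<close>.\<close>

type_synonym point = "int \<times> int \<times> int"

definition V :: "int \<Rightarrow> point set" where
  "V m = {0..<m} \<times> {0..<m} \<times> {0..<m}"

definition S :: "int \<Rightarrow> point \<Rightarrow> int" where
  "S m = (\<lambda>(i, j, k). (i + j + k) mod m)"

definition step :: "int \<Rightarrow> nat \<Rightarrow> point \<Rightarrow> point" where
  "step m d = (\<lambda>(i, j, k).
     if d = 0 then ((i + 1) mod m, j, k)
     else if d = 1 then (i, (j + 1) mod m, k)
     else (i, j, (k + 1) mod m))"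

text \<open>For \<open>m \<ge> 3\<close> the three arcs leaving a vertex have distinct heads, so arcs can be
  represented by their pairs of end points.\<close>

definition D3 :: "int \<Rightarrow> (point, point \<times> point) pre_digraph" where
  "D3 m = \<lparr>verts = V m, arcs = {(v, step m d v) |v d. v \<in> V m \<and> d \<in> {0, 1, 2}},
     tail = fst, head = snd\<rparr>"

definition X102 :: "int \<Rightarrow> point set" where
  "X102 m = {(0, 0, 0)} \<union> {(i, 1, m - 1 - i) |i. 1 \<le> i \<and> i \<le> m - 3} \<union> {(m - 1, 2, m - 1)}"

definition X021 :: "int \<Rightarrow> point set" where
  "X021 m = {(0, 1, m - 1)} \<union> {(i, m - i, 0) |i. 1 \<le> i \<and> i \<le> m - 3} \<union> {(m - 1, 0, 1)}"

definition X210 :: "int \<Rightarrow> point set" where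
  "X210 m = {(0, j, m - j) |j. 2 \<le> j \<and> j \<le> m - 1} \<union> {(1, 0, m - 1)}"

definition Y102 :: "int \<Rightarrow> point set" where
  "Y102 m = {(0, 0, 0)} \<union> {(i, 1, m - 1 - i) |i. 2 \<le> i \<and> i \<le> m - 3} \<union> {(m - 1, 2, m - 1)}"

definition Y021 :: "int \<Rightarrow> point set" where
  "Y021 m = {(0, 1, m - 1)} \<union> {(i, m - i, 0) |i. 2 \<le> i \<and> i \<le> m - 3} \<union> {(m - 1, 0, 1)}"

definition Y210 :: "int \<Rightarrow> point set" where
  "Y210 m = {(0, j, m - j) |j. 2 \<le> j \<and> j \<le> m - 1} \<union> {(1, 0, m - 1)}
     \<union> {(1, j, m - 1 - j) |j. 2 \<le> j \<and> j \<le> m - 2} \<union> {(2, 0, m - 2), (2, m - 1, m - 1)}"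

text \<open>The sets tested in the two case distinctions below are pairwise disjoint for \<open>m \<ge> 6\<close>
  (see the lemmas that follow), so the order of the tests is immaterial.\<close>

definition layer0_X :: "int \<Rightarrow> point \<Rightarrow> nat list" where
  "layer0_X m v =
    (if v \<in> X102 m then [1, 0, 2]
     else if v \<in> X021 m then [0, 2, 1]
     else if v \<in> X210 m then [2, 1, 0]
     else if v = (m - 2, 1, 1) then [0, 1, 2]
     else if v = (m - 2, 2, 0) then [2, 0, 1]
     else [1, 2, 0])"

definition layer0_Y :: "int \<Rightarrow> point \<Rightarrow> nat list" where
  "layer0_Y m v =
    (if v \<in> Y102 m then [1, 0, 2]
     else if v \<in> Y021 m then [0, 2, 1]
     else if v \<in> Y210 m then [2, 1, 0]
     else if v \<in> {(1, 1, m - 2), (m - 2, 1, 1)} then [0, 1, 2]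
     else if v \<in> {(1, m - 1, 0), (m - 2, 2, 0)} then [2, 0, 1]
     else [1, 2, 0])"

lemma layer0_X_disjoint:
  assumes "m \<ge> 6"
  shows "X102 m \<inter> X021 m = {}" "X102 m \<inter> X210 m = {}" "X021 m \<inter> X210 m = {}"
    "{(m - 2, 1, 1), (m - 2, 2, 0)} \<inter> (X102 m \<union> X021 m \<union> X210 m) = {}"
  using assms by (auto simp: X102_def X021_def X210_def)

lemma layer0_Y_disjoint:
  assumes "m \<ge> 6"
  shows "Y102 m \<inter> Y021 m = {}" "Y102 m \<inter> Y210 m = {}" "Y021 m \<inter> Y210 m = {}"
    "{(1, 1, m - 2), (m - 2, 1, 1), (1, m - 1, 0), (m - 2, 2, 0)}
       \<inter> (Y102 m \<union> Y021 m \<union> Y210 m) = {}"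
  using assms by (auto simp: Y102_def Y021_def Y210_def)

text \<open>The list \<open>[d\<^sub>0(v), d\<^sub>1(v), d\<^sub>2(v)]\<close>. Only even \<open>m\<close> are of interest, so that the
  last case is \<open>m mod 6 = 4\<close>.\<close>

definition route_E :: "int \<Rightarrow> point \<Rightarrow> nat list" where
  "route_E m v =
    (if S m v = 0 then (if m mod 6 \<in> {0, 2} then layer0_X m v else layer0_Y m v)
     else if S m v = 1 then (if fst v = 0 then [1, 0, 2] else [2, 0, 1])
     else if S m v = 2 then (if fst (snd v) = 0 then [2, 1, 0] else [0, 1, 2])
     else [0, 1, 2])"

definition route_E_map :: "int \<Rightarrow> nat \<Rightarrow> point \<Rightarrow> point" where
  "route_E_map m c v = step m (route_E m v ! c) v"

definition color_class :: "int \<Rightarrow> nat \<Rightarrow> (point \<times> point) set" where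
  "color_class m c = {(v, route_E_map m c v) |v. v \<in> V m}"

text \<open>A cycle \<open>p\<close> (a list of arcs) of the library repeats no vertex except its start, so it is
  Hamiltonian once the tails of its arcs exhaust the vertices.\<close>

definition directed_hamilton_cycle :: "('a, 'b) pre_digraph \<Rightarrow> 'b list \<Rightarrow> bool" where
  "directed_hamilton_cycle G p \<longleftrightarrow> pre_digraph.cycle G p \<and> tail G ` set p = verts G"

end

theory Submission
  imports Defs
begin

text \<open>A permutation of a finite set is a single cycle iff every function that is constant along its
  orbits is constant. So for each colour \<open>c\<close> we take a function \<open>H\<close> invariant under \<open>f\<^sub>c\<close> and
  restrict it to the layer \<open>S = 0\<close>, where it becomes a doubly periodic function \<open>h i j\<close> invariant under
  the \<open>m\<close>-th iterate of \<open>f\<^sub>c\<close>. This iterate is a fixed translation of \<open>(\<int>/m)\<^sup>2\<close> except on a few lines, so its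
  return map to a suitable row or column can be followed explicitly; it is a translation of \<open>\<int>/m\<close>
  with finitely many exceptions, and the exceptions link its residue classes to one another.\<close>

section \<open>Doubly periodic functions\<close>

text \<open>Working with invariants instead of orbits means that only equalities
  \<open>h i j = h i' j'\<close> are chained: no return times are counted, and a path may be entered
  anywhere and read in either direction. Repeated over all rows or columns, the generic translation
  ((-2, 1), (1, -2), (1, 1) for colours 0, 1, 2) adds up to 0 modulo \<open>m\<close>, so a return
  shift is the sum of the corrections collected on the exceptional lines. As \<open>m\<close> is
  even, the parity of a row or column survives reduction modulo \<open>m\<close>, and it decides
  which of these lines a path can meet.

  The obstacle is colour 1. With \<open>layer0_X\<close> and \<open>m mod 6 = 4\<close> its return
  map would split into three cycles: even rows advance by 6, and the ends \<open>m - 8\<close>,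
  \<open>m - 6\<close>, \<open>m - 4\<close> of the three progressions would each lead back to the
  start of the same progression. \<open>layer0_Y\<close> changes columns 1 and 2 only; this alters
  the shifts of colours 0 and 1 and leaves colour 2 as it is.

  Bijectivity is proved separately, by comparing directions, since constancy of invariants alone
  does not make a map a permutation.\<close>

locale torus_invariant =
  fixes m :: int and h :: "int \<Rightarrow> int \<Rightarrow> 'b"
  assumes m_ge: "6 \<le> m" and m_even: "even m"
    and period_i: "\<And>i j. h (i + m) j = h i j"
    and period_j: "\<And>i j. h i (j + m) = h i j"
begin

lemma shift_i: "h (i + q * m) j = h i j"
proof (induct q rule: int_induct[where k = 0])
  case (step1 q) then show ?case using period_i[of "i + q * m" j] by (simp add: algebra_simps)
next
  case (step2 q) then show ?case using period_i[of "i + (q - 1) * m" j] by (simp add: algebra_simps)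
qed simp

lemma shift_j: "h i (j + q * m) = h i j"
proof (induct q rule: int_induct[where k = 0])
  case (step1 q) then show ?case using period_j[of i "j + q * m"] by (simp add: algebra_simps)
next
  case (step2 q) then show ?case using period_j[of i "j + (q - 1) * m"] by (simp add: algebra_simps)
qed simp

lemma h_eqI:
  assumes "i' = i + q * m" "j' = j + p * m"
  shows "h i j = h i' j'"
  using assms by (simp add: shift_i shift_j)

text \<open>Brings a point into the range where \<open>move\<close> applies; with the offsets
  \<open>a\<close> and \<open>b\<close> both sides of a move can be translated back.\<close>

lemma h_mod: "h (i mod m + a) (j mod m + b) = h (i + a) (j + b)"
  using h_eqI[of "i + a" "i mod m + a" "i div m" "j + b" "j mod m + b" "j div m"]
  by (simp add: algebra_simps minus_mod_eq_mult_div[symmetric])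

lemma h_mod_j: "h i (j mod m) = h i j"
  using h_mod[of 0 i j 0] by simp

lemma add_mod_eq_0_imp:
  assumes "(i + j) mod m = 0" "0 < j" "j < m"
  shows "i mod m + j = m"
proof -
  have "m dvd i mod m + j - m" using assms(1) by (simp add: mod_add_left_eq dvd_eq_mod_eq_0)
  moreover have "\<bar>i mod m + j - m\<bar> < m"
    using assms m_ge pos_mod_bound[of m i] pos_mod_sign[of m i] by linarith
  ultimately show ?thesis using dvd_imp_le_int[of "i mod m + j - m" m] by linarith
qed

lemma m_half: obtains k where "m = 2 * k" "3 \<le> k"
  using m_even m_ge by (auto elim!: evenE)

text \<open>Row \<open>m\<close> is row \<open>0\<close> by periodicity, so rising row by row ends
  where \<open>h\<close> is known. The column reached does not matter, because \<open>row0\<close>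
  covers every column.\<close>

lemma const_if_climb:
  assumes row0: "\<And>i. h i 0 = h 0 0"
    and climb: "\<And>i j. 1 \<le> j \<Longrightarrow> j < m \<Longrightarrow> \<exists>i'. h i j = h i' (j + 1)"
    and "0 \<le> j" "j \<le> m"
  shows "h i j = h 0 0"
  using assms(4,3)
proof (induct j arbitrary: i rule: int_le_induct)
  case base
  show ?case using row0[of i] period_j[of i 0] by simp
next
  case (step j)
  show ?case
  proof (cases "j = 1")
    case True then show ?thesis using row0[of i] by simp
  next
    case False
    then show ?thesis using climb[of "j - 1" i] step by auto
  qed
qed

text \<open>The analogue for columns. Moves of colour 1 may cross two columns at once, so the
  induction is on the distance to column \<open>m\<close>; the alternative \<open>i' = 0\<close>
  absorbs a move that would overshoot it.\<close>

lemma const_if_advance: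
  assumes col0: "\<And>j. h 0 j = h 0 0"
    and advance: "\<And>i j. 1 \<le> i \<Longrightarrow> i < m \<Longrightarrow>
      \<exists>i' j'. h i j = h i' j' \<and> (i' = 0 \<or> i < i' \<and> i' \<le> m)"
    and "0 \<le> i" "i \<le> m"
  shows "h i j = h 0 0"
  using assms(3,4)
proof (induct "nat (m - i)" arbitrary: i j rule: less_induct)
  case less
  consider "i = 0" | "i = m" | "1 \<le> i" "i < m" using less.prems by linarith
  then show ?case
  proof cases
    case 1 then show ?thesis using col0[of j] by simp
  next
    case 2 then show ?thesis using col0[of j] period_i[of 0 j] by simp
  next
    case 3
    then obtain i' j' where *: "h i j = h i' j'" "i' = 0 \<or> i < i' \<and> i' \<le> m"
      using advance by blast
    then show ?thesis using less.hyps[of i' j'] col0[of j'] 3 by auto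
  qed
qed

end

section \<open>Colour 2\<close>

text \<open>Here and below, \<open>move\<close> expresses invariance under the \<open>m\<close>-th iterate of \<open>f\<^sub>c\<close> on the layer
  \<open>S = 0\<close>. The return map to the row \<open>j = 0\<close> is \<open>i \<mapsto> i - 1\<close>, except that \<open>0 \<mapsto> 1 \<mapsto> m - 1\<close> and \<open>2 \<mapsto> 0\<close>.\<close>

locale color2_invariant = torus_invariant +
  assumes move: "\<And>i j. \<lbrakk>0 \<le> i; i < m; 0 \<le> j; j < m\<rbrakk> \<Longrightarrow> h i j =
    (if j = 0 then if i = 0 then h 1 0 else if i = m - 1 then h i 2 else h (i + 1) 1
     else if i = m - 1 then if j = 2 then h i 3 else h 0 j
     else if j = 1 then h i 2
     else if i + j = m then if j = m - 2 then h (i + 1) 0 else h i (j + 2)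
     else if j = m - 1 then h (i + 2) 0
     else h (i + 1) (j + 1))"
begin

text \<open>Along the run \<open>i + j\<close> grows by 2. It misses the exceptional antidiagonal
  \<open>i + j = m\<close> if it is odd (as \<open>m\<close> is even), if it reaches
  \<open>m\<close> at the last point at the earliest, or if it starts above
  \<open>m\<close>.\<close>

lemma run:
  assumes "0 \<le> n" "0 \<le> i" "i + n \<le> m - 1" "2 \<le> j" "j + n \<le> m - 1"
    and "odd (i + j) \<or> i + j + 2 * n \<le> m \<or> m < i + j"
  shows "h i j = h (i + n) (j + n)"
  using assms(1,3,5,6)
proof (induct n rule: int_ge_induct)
  case (step n)
  have "i + n + (j + n) \<noteq> m"
    using step.prems(3) step.hyps(1) m_even by presburger
  then have "h (i + n) (j + n) = h (i + n + 1) (j + n + 1)"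
    using step assms by (subst move) auto
  with step show ?case by (auto simp: algebra_simps)
qed simp

text \<open>The path meets the antidiagonal once: for even \<open>i\<close> after the passage from
  column \<open>m - 1\<close> to column \<open>0\<close>, for odd \<open>i\<close> before it. Since
  \<open>6 \<le> i\<close>, the meeting point \<open>(k, m - k)\<close> stays below row
  \<open>m - 2\<close>, where the jump over two rows would already return to row
  \<open>0\<close>.\<close>

lemma row0_pred_even:
  assumes "even i" "6 \<le> i" "i \<le> m - 4"
  shows "h i 0 = h (i - 1) 0"
proof -
  obtain k where i: "i = 2 * k" using assms by (auto elim: evenE)
  have "h i 0 = h (i + 1) 1" using assms by (subst move) auto
  also have "\<dots> = h (i + 1) 2" using assms by (subst move) auto
  also have "\<dots> = h (m - 1) (m - i)"
    using run[of "m - 2 - i" "i + 1" 2] assms m_even by auto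
  also have "\<dots> = h 0 (m - i)" using assms by (subst move) auto
  also have "\<dots> = h k (m - k)"
    using run[of k 0 "m - i"] assms i by auto
  also have "\<dots> = h k (m - k + 2)" using assms i by (subst move) auto
  also have "\<dots> = h (i - 3) (m - 1)"
    using run[of "k - 3" k "m - k + 2"] assms i by auto
  also have "\<dots> = h (i - 1) 0" using assms i by (subst move) auto
  finally show ?thesis .
qed

lemma row0_pred_odd:
  assumes "odd i" "3 \<le> i" "i \<le> m - 3"
  shows "h i 0 = h (i - 1) 0"
proof -
  obtain k where i: "i = 2 * k + 1" using assms by (auto elim: oddE)
  obtain l where m: "m = 2 * l" "3 \<le> l" by (rule m_half)
  have "h i 0 = h (i + 1) 1" using assms by (subst move) auto
  also have "\<dots> = h (i + 1) 2" using assms by (subst move) auto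
  also have "\<dots> = h (l + k) (l - k)"
    using run[of "l - k - 2" "i + 1" 2] assms i m by (auto simp: add.commute)
  also have "\<dots> = h (l + k) (l - k + 2)" using assms i m by (subst move) auto
  also have "\<dots> = h (m - 1) (m - i + 2)"
    using run[of "l - k - 1" "l + k" "l - k + 2"] assms i m by (auto simp: algebra_simps)
  also have "\<dots> = h 0 (m - i + 2)" using assms i m by (subst move) auto
  also have "\<dots> = h (i - 3) (m - 1)"
    using run[of "i - 3" 0 "m - i + 2"] assms i m by auto
  \<comment> \<open>Excludes column \<open>i - 3 = 1\<close>, in which row \<open>m - 1\<close>
    meets the antidiagonal.\<close>
  also have "i \<noteq> 4" using assms by auto
  then have "h (i - 3) (m - 1) = h (i - 1) 0" using assms m_ge by (subst move) auto
  finally show ?thesis .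
qed

lemma row0_4: "m \<ge> 8 \<Longrightarrow> h 4 0 = h 3 0"
proof -
  assume m: "m \<ge> 8"
  have "h 4 0 = h 5 1" using m by (subst move) auto
  also have "\<dots> = h 5 2" using m by (subst move) auto
  also have "\<dots> = h (m - 1) (m - 4)"
    using run[of "m - 6" 5 2] m by auto
  also have "\<dots> = h 0 (m - 4)" using m by (subst move) auto
  also have "\<dots> = h 2 (m - 2)" using run[of 2 0 "m - 4"] m by auto
  also have "\<dots> = h 3 0" using m by (subst move) auto
  finally show ?thesis .
qed

lemma row0_m2: "h (m - 2) 0 = h (m - 3) 0"
proof -
  obtain l where m: "m = 2 * l" "3 \<le> l" by (rule m_half)
  have "h (m - 2) 0 = h (m - 1) 1" using m by (subst move) auto
  also have "\<dots> = h 0 1" using m by (subst move) auto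
  also have "\<dots> = h 0 2" using m by (subst move) auto
  also have "\<dots> = h (l - 1) (l + 1)" using run[of "l - 1" 0 2] m by (auto simp: add.commute)
  also have "\<dots> = h (m - 3) 0"
  proof (cases "l = 3")
    \<comment> \<open>Here \<open>m = 6\<close> and the point is \<open>(2, m - 2)\<close>, from
      which the jump lands in row \<open>0\<close> at once.\<close>
    case True then show ?thesis using m by (subst move) auto
  next
    case False
    then have "h (l - 1) (l + 1) = h (l - 1) (l + 3)" using m by (subst move) (auto simp: add.commute)
    also have "\<dots> = h (m - 5) (m - 1)" using run[of "l - 4" "l - 1" "l + 3"] m False by auto
    also have "\<dots> = h (m - 3) 0" using m False by (subst move) auto
    finally show ?thesis .
  qed
  finally show ?thesis .
qed

lemma row0_m1: "h (m - 1) 0 = h (m - 2) 0"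
proof -
  have "h (m - 1) 0 = h (m - 1) 2" using m_ge by (subst move) auto
  also have "\<dots> = h (m - 1) 3" using m_ge by (subst move) auto
  also have "\<dots> = h 0 3" using m_ge by (subst move) auto
  also have "\<dots> = h (m - 4) (m - 1)" using run[of "m - 4" 0 3] m_ge by auto
  also have "\<dots> = h (m - 2) 0" using m_ge by (subst move) auto
  finally show ?thesis .
qed

lemma h_1_m1: "h 1 (m - 1) = h 0 0"
proof -
  have "h 1 (m - 1) = h 1 (m + 1)" using m_ge by (subst move) (auto simp: add.commute)
  also have "\<dots> = h 1 1" using period_j[of 1 1] by (simp add: add.commute)
  also have "\<dots> = h 1 2" using m_ge by (subst move) auto
  also have "\<dots> = h (m - 2) (m - 1)" using run[of "m - 3" 1 2] m_ge by auto
  also have "\<dots> = h m 0" using m_ge by (subst move) auto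
  also have "\<dots> = h 0 0" using period_i[of 0 0] by simp
  finally show ?thesis .
qed

lemma row0_2: "h 2 0 = h 0 0"
proof -
  have "h 2 0 = h 3 1" using m_ge by (subst move) auto
  also have "\<dots> = h 3 2" using m_ge by (subst move) auto
  also have "\<dots> = h (m - 1) (m - 2)" using run[of "m - 4" 3 2] m_ge by auto
  also have "\<dots> = h 0 (m - 2)" using m_ge by (subst move) auto
  also have "\<dots> = h 1 (m - 1)" using m_ge by (subst move) auto
  finally show ?thesis using h_1_m1 by simp
qed

lemma row0_1: "h 1 0 = h (m - 1) 0"
proof -
  obtain l where m: "m = 2 * l" "3 \<le> l" by (rule m_half)
  have "h 1 0 = h 2 1" using m by (subst move) auto
  also have "\<dots> = h 2 2" using m by (subst move) auto
  also have "\<dots> = h l l" using run[of "l - 2" 2 2] m by auto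
  also have "\<dots> = h l (l + 2)" using m by (subst move) auto
  also have "\<dots> = h (m - 3) (m - 1)" using run[of "l - 3" l "l + 2"] m by auto
  also have "\<dots> = h (m - 1) 0" using m by (subst move) auto
  finally show ?thesis .
qed

lemma row0_pred:
  assumes "3 \<le> i" "i \<le> m - 1"
  shows "h i 0 = h (i - 1) 0"
proof -
  have "i = m - 1 \<or> i = m - 2 \<or> (odd i \<and> i \<le> m - 3) \<or> (even i \<and> 6 \<le> i \<and> i \<le> m - 4)
      \<or> (i = 4 \<and> i \<le> m - 4)"
    using assms m_even by presburger
  then show ?thesis
    using assms row0_m1 row0_m2 row0_pred_odd row0_pred_even row0_4 by auto
qed

lemma row0_const:
  assumes "0 \<le> i" "i < m"
  shows "h i 0 = h 0 0"
proof -
  have *: "h i 0 = h 0 0" if "2 \<le> i" "i \<le> m - 1" for i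
    using that
  proof (induct i rule: int_ge_induct)
    case base show ?case by (rule row0_2)
  next
    case (step i) then show ?case using row0_pred[of "i + 1"] by simp
  qed
  consider "i = 0" | "i = 1" | "2 \<le> i" using assms by linarith
  then show ?thesis using *[of i] *[of "m - 1"] row0_1 assms m_ge by cases auto
qed

lemma const:
  assumes "0 \<le> i" "i < m" "0 \<le> j" "j < m"
  shows "h i j = h 0 0"
  using assms
\<comment> \<open>Short of a return to row \<open>0\<close>, every move raises \<open>j\<close>,
  except that column \<open>m - 1\<close> may pass to column \<open>0\<close> of the same row; the
  extra unit makes the measure drop there too.\<close>
proof (induct "nat (2 * (m - j) + (if i = m - 1 then 1 else 0))" arbitrary: i j rule: less_induct)
  case less
  have IH: "h i' j' = h 0 0" if "j < j' \<or> j = j' \<and> i = m - 1 \<and> i' = 0" "0 \<le> i'" "i' < m" "j' < m" for i' j'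
    by (rule less.hyps) (use that less.prems m_ge in auto)
  have period: "h m k = h 0 k" for k using period_i[of 0 k] by simp
  consider (start) "j = 0" | (last) "i = m - 1" "j \<noteq> 0"
    | (row1) "i \<noteq> m - 1" "j = 1" | (wrap) "i = 1" "j = m - 1" | (anti2) "i = 2" "j = m - 2"
    | (anti) "j \<notin> {0, 1}" "i \<notin> {1, 2, m - 1}" "i + j = m"
    | (top) "i \<notin> {1, m - 1}" "j = m - 1"
    | (generic) "j \<notin> {0, 1, m - 1}" "i \<noteq> m - 1" "i + j \<noteq> m"
    using less.prems by force
  then show ?case
  proof cases
    case start
    then show ?thesis using row0_const[of i] less.prems by simp
  next
    case wrap
    then show ?thesis using h_1_m1 by simp
  next
    case last
    then show ?thesis using less.prems m_ge IH[of 3 i] IH[of j 0] by (subst move) auto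
  next
    case row1
    then show ?thesis using less.prems m_ge IH[of 2 i] by (subst move) auto
  next
    case anti2
    then show ?thesis using less.prems m_ge row0_const[of 3] by (subst move) auto
  next
    case anti
    then show ?thesis using less.prems m_ge IH[of "j + 2" i] by (subst move) auto
  next
    case top
    then show ?thesis
      using less.prems m_ge row0_const[of "i + 2"] period[of 0]
      by (cases "i = m - 2"; subst move) auto
  next
    case generic
    then show ?thesis using less.prems m_ge IH[of "j + 1" "i + 1"] by (subst move) auto
  qed
qed

end

section \<open>Colour 0\<close>

text \<open>For \<open>m mod 6 \<noteq> 4\<close> the return map to the row \<open>j = 0\<close> is \<open>i \<mapsto> i - 2\<close> for \<open>i \<ge> 2\<close>, and
  \<open>0 \<mapsto> m - 1\<close> joins the two parities.\<close>

locale color0X_invariant = torus_invariant +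
  assumes move: "\<And>i j. \<lbrakk>0 \<le> i; i < m; 0 \<le> j; j < m\<rbrakk> \<Longrightarrow> h i j =
    (if i = 0 \<and> j = 0 then h (i - 2) (j + 2)
     else if i = m - 1 \<and> j = 0 then h (i - 1) (j + 1)
     else if i = 1 \<and> j = 0 then h (i - 3) j
     else if i = m - 2 \<and> j = 2 then h (i - 2) j
     else if (i = 0 \<or> i = m - 2) \<and> j = 1 \<or> i + j = m \<and> 3 \<le> j then h (i - 1) j
     else if j = m - 1 then h (i - 3) (j + 1)
     else h (i - 2) (j + 1))"
begin

text \<open>Here and in \<open>diag\<close> the column is any integer, so a path can run into
  negative columns and be wrapped only at the end.\<close>

lemma anti:
  assumes "3 \<le> j" "j < m" "(i + j) mod m = 0"
  shows "h i j = h (i - 1) j"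
proof -
  have "i mod m + j = m" using add_mod_eq_0_imp[OF assms(3)] assms by simp
  then have "h (i mod m) j = h (i mod m - 1) j" using assms m_ge by (subst move) auto
  then show ?thesis using h_mod[of i 0 j 0] h_mod[of i "- 1" j 0] assms by simp
qed

lemma diag:
  assumes "2 \<le> j" "j < m - 1" "(i + j) mod m \<noteq> 0"
  shows "h i j = h (i - 2) (j + 1)"
proof -
  have "i mod m + j \<noteq> m" using assms(3) by (metis mod_add_left_eq mod_self)
  then have "h (i mod m) j = h (i mod m - 2) (j + 1)" using assms m_ge by (subst move) auto
  then show ?thesis using h_mod[of i 0 j 0] h_mod[of i "- 2" j 1] assms by simp
qed

text \<open>Each step lowers \<open>i + j\<close> by 1, so the sum stays strictly between
  \<open>0\<close> and \<open>m\<close> up to the last point, which alone may lie on the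
  antidiagonal.\<close>

lemma run:
  assumes "0 \<le> n" "2 \<le> j" "j + n \<le> m - 1" "n \<le> i + j" "i + j < m"
  shows "h i j = h (i - 2 * n) (j + n)"
  using assms(1,3,4)
proof (induct n rule: int_ge_induct)
  case (step n)
  have "(i - 2 * n + (j + n)) mod m = i + j - n"
    using step.prems step.hyps assms by (simp add: mod_pos_pos_trivial)
  then have "h (i - 2 * n) (j + n) = h (i - 2 * n - 2) (j + n + 1)"
    using step assms by (intro diag) auto
  with step show ?case by (auto simp: algebra_simps)
qed simp

lemma row0_0: "h 0 0 = h (m - 1) 0"
proof -
  have "h 0 0 = h (- 2) 2" using m_ge by (subst move) auto
  also have "\<dots> = h (m - 2) 2" by (rule h_eqI[where q = 1 and p = 0]) auto
  also have "\<dots> = h (m - 4) 2" using m_ge by (subst move) auto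
  also have "\<dots> = h (2 - m) (m - 1)" using run[of "m - 3" 2 "m - 4"] m_ge by (auto simp: algebra_simps)
  also have "\<dots> = h 2 (m - 1)" by (rule h_eqI[where q = 1 and p = 0]) auto
  also have "\<dots> = h (- 1) m" using m_ge by (subst move) auto
  also have "\<dots> = h (m - 1) 0" by (rule h_eqI[where q = 1 and p = "- 1"]) auto
  finally show ?thesis .
qed

lemma row0_2: "h 2 0 = h 0 0"
proof -
  have "h 2 0 = h 0 1" using m_ge by (subst move) auto
  also have "\<dots> = h (- 1) 1" using m_ge by (subst move) auto
  also have "\<dots> = h (m - 1) 1" by (rule h_eqI[where q = 1 and p = 0]) auto
  also have "\<dots> = h (m - 3) 2" using m_ge by (subst move) auto
  also have "\<dots> = h (3 - m) (m - 1)" using run[of "m - 3" 2 "m - 3"] m_ge by (auto simp: algebra_simps)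
  also have "\<dots> = h 3 (m - 1)" by (rule h_eqI[where q = 1 and p = 0]) auto
  also have "\<dots> = h 0 m" using m_ge by (subst move) auto
  also have "\<dots> = h 0 0" by (rule h_eqI[where q = 0 and p = "- 1"]) auto
  finally show ?thesis .
qed

lemma row0_m1: "h (m - 1) 0 = h (m - 3) 0"
proof -
  have "h (m - 1) 0 = h (m - 2) 1" using m_ge by (subst move) auto
  also have "\<dots> = h (m - 3) 1" using m_ge by (subst move) auto
  also have "\<dots> = h (m - 5) 2" using m_ge by (subst move) auto
  also have "\<dots> = h (1 - m) (m - 1)" using run[of "m - 3" 2 "m - 5"] m_ge by (auto simp: algebra_simps)
  also have "\<dots> = h (- m) (m - 1)" using anti[of "m - 1" "1 - m"] m_ge by simp
  also have "\<dots> = h 0 (m - 1)" by (rule h_eqI[where q = 1 and p = 0]) auto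
  also have "\<dots> = h (- 3) m" using m_ge by (subst move) auto
  also have "\<dots> = h (m - 3) 0" by (rule h_eqI[where q = 1 and p = "- 1"]) auto
  finally show ?thesis .
qed

text \<open>Two corrections make up the shift by \<open>- 2\<close>: the path loses one column at
  \<open>(- i, i)\<close>, where it meets the antidiagonal, and one more in row
  \<open>m - 1\<close>, which moves by 3 columns instead of 2.\<close>

lemma row0_mid:
  assumes "3 \<le> i" "i \<le> m - 2"
  shows "h i 0 = h (i - 2) 0"
proof -
  have "h i 0 = h (i - 2) 1" using assms by (subst move) auto
  also have "\<dots> = h (i - 4) 2" using assms by (subst move) auto
  also have "\<dots> = h (- i) i" using run[of "i - 2" 2 "i - 4"] assms by (auto simp: algebra_simps)
  also have "\<dots> = h (- i - 1) i" using anti[of i "- i"] assms by auto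
  also have "\<dots> = h (m - i - 1) i" by (rule h_eqI[where q = 1 and p = 0]) auto
  also have "\<dots> = h (i + 1 - m) (m - 1)"
    using run[of "m - 1 - i" i "m - i - 1"] assms by (auto simp: algebra_simps)
  also have "\<dots> = h (i + 1) (m - 1)" by (rule h_eqI[where q = 1 and p = 0]) auto
  also have "\<dots> = h (i - 2) m" using assms by (subst move) auto
  also have "\<dots> = h (i - 2) 0" by (rule h_eqI[where q = 0 and p = "- 1"]) auto
  finally show ?thesis .
qed

lemma row0_minus2:
  assumes "2 \<le> i" "i < m"
  shows "h i 0 = h (i - 2) 0"
proof -
  have "i = 2 \<or> i = m - 1 \<or> 3 \<le> i \<and> i \<le> m - 2" using assms by linarith
  then show ?thesis using row0_2 row0_m1 row0_mid by auto
qed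

lemma row0_parity:
  assumes "0 \<le> i" "i < m"
  shows "h i 0 = h (i mod 2) 0"
  using assms
proof (induct "nat i" arbitrary: i rule: less_induct)
  case less
  show ?case
  proof (cases "i < 2")
    case False
    then have "h (i - 2) 0 = h ((i - 2) mod 2) 0" using less.prems by (intro less.hyps) auto
    moreover have "(i - 2) mod 2 = i mod 2" by presburger
    ultimately show ?thesis using row0_minus2[of i] False less.prems by simp
  qed (use less.prems in auto)
qed

lemma row0_const: "h i 0 = h 0 0"
proof -
  have "(m - 1) mod 2 = 1" using m_even by presburger
  then have "h 1 0 = h 0 0" using row0_parity[of "m - 1"] row0_0 m_ge by simp
  moreover have "h i 0 = h (i mod m mod 2) 0"
    using row0_parity[of "i mod m"] h_mod[of i 0 0 0] m_ge by simp
  moreover have "i mod m mod 2 = 0 \<or> i mod m mod 2 = 1" by presburger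
  ultimately show ?thesis by auto
qed

lemma climb:
  assumes "1 \<le> j" "j < m"
  shows "\<exists>i'. h i j = h i' (j + 1)"
proof -
  let ?i = "i mod m"
  have i: "0 \<le> ?i" "?i < m" and hi: "h i j = h ?i j" using m_ge h_mod[of i 0 j 0]
    h_mod[of ?i 0 j 0] by auto
  have "j = 1 \<or> j = 2 \<or> 3 \<le> j \<and> j < m - 1 \<or> j = m - 1" using assms by linarith
  then show ?thesis
  proof (elim disjE conjE)
    assume j: "j = 1"
    have "h 0 1 = h (- 1) 1" using m_ge by (subst move) auto
    also have "\<dots> = h (m - 1) 1" by (rule h_eqI[where q = 1 and p = 0]) auto
    also have "\<dots> = h (m - 3) 2" using m_ge by (subst move) auto
    finally have "h 0 1 = h (m - 3) 2" .
    moreover have "h (m - 2) 1 = h (m - 3) 1" using m_ge by (subst move) auto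
    then have "h (m - 2) 1 = h (m - 5) 2" using m_ge by (subst (asm) (2) move) auto
    moreover have "h ?i 1 = h (?i - 2) 2" if "?i \<noteq> 0" "?i \<noteq> m - 2"
      using that i m_ge by (subst move) auto
    ultimately show ?thesis using j hi by (metis one_add_one)
  next
    assume j: "j = 2"
    have "h (m - 2) 2 = h (m - 4) 2" using m_ge by (subst move) auto
    then have "h (m - 2) 2 = h (m - 6) 3" using m_ge by (subst (asm) (2) move) auto
    moreover have "h ?i 2 = h (?i - 2) 3" if "?i \<noteq> m - 2"
      using that i m_ge by (subst move) auto
    ultimately show ?thesis using j hi by (metis numeral_plus_one semiring_norm(5))
  next
    assume j: "3 \<le> j" "j < m - 1"
    have "(i - 1 + j) mod m \<noteq> 0" if "(i + j) mod m = 0"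
    proof
      assume "(i - 1 + j) mod m = 0"
      then have "m dvd (i + j) - (i - 1 + j)" using that by (intro dvd_diff) auto
      then show False using m_ge by simp
    qed
    then show ?thesis using anti[of j i] diag[of j i] diag[of j "i - 1"] j
      by (cases "(i + j) mod m = 0") auto
  next
    assume j: "j = m - 1"
    have *: "h k (m - 1) = h (k - 3) m" if "0 \<le> k" "k < m" "k \<noteq> 1" for k
      using that m_ge by (subst move) auto
    have "h 1 (m - 1) = h 0 (m - 1)" using m_ge by (subst move) auto
    then show ?thesis using j hi *[of ?i] *[of 0] i m_ge by (cases "?i = 1") auto
  qed
qed

lemma const: "0 \<le> j \<Longrightarrow> j \<le> m \<Longrightarrow> h i j = h 0 0"
  by (rule const_if_climb[OF row0_const climb])

end

text \<open>For \<open>m mod 6 = 4\<close> the extra exceptions on the column \<open>i = 1\<close> turn the return map into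
  \<open>i \<mapsto> i - 4\<close> for \<open>i \<ge> 4\<close>; the values at \<open>0, \<dots>, 3\<close> join the residue classes modulo 4.\<close>

locale color0Y_invariant = torus_invariant +
  assumes move: "\<And>i j. \<lbrakk>0 \<le> i; i < m; 0 \<le> j; j < m\<rbrakk> \<Longrightarrow> h i j =
    (if i = 0 \<and> j = 0 then h (i - 2) (j + 2)
     else if i = m - 1 \<and> j = 0 then h (i - 1) (j + 1)
     else if (i = 1 \<or> i = 2) \<and> j = 0 then h (i - 3) j
     else if i = m - 2 \<and> j = 2 \<or> i = 1 \<and> 2 \<le> j \<or> i = 2 \<and> j = m - 1 then h (i - 2) j
     else if (i = 0 \<or> i = 1 \<or> i = m - 2) \<and> j = 1 \<or> i + j = m \<and> 3 \<le> j then h (i - 1) j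
     else if j = m - 1 then h (i - 3) (j + 1)
     else h (i - 2) (j + 1))"
begin

lemma anti:
  assumes "3 \<le> j" "j < m - 1" "(i + j) mod m = 0"
  shows "h i j = h (i - 1) j"
proof -
  have "i mod m + j = m" using add_mod_eq_0_imp[OF assms(3)] assms by simp
  then have "h (i mod m) j = h (i mod m - 1) j" using assms m_ge by (subst move) auto
  then show ?thesis using h_mod[of i 0 j 0] h_mod[of i "- 1" j 0] assms by simp
qed

lemma diag:
  assumes "2 \<le> j" "j < m - 1" "(i + j) mod m \<noteq> 0" "i mod m \<noteq> 1"
  shows "h i j = h (i - 2) (j + 1)"
proof -
  have "i mod m + j \<noteq> m" using assms(3) by (metis mod_add_left_eq mod_self)
  then have "h (i mod m) j = h (i mod m - 2) (j + 1)" using assms m_ge by (subst move) auto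
  then show ?thesis using h_mod[of i 0 j 0] h_mod[of i "- 2" j 1] assms by simp
qed

lemma col1:
  assumes "2 \<le> j" "j < m"
  shows "h 1 j = h (m - 1) j"
proof -
  have "h 1 j = h (- 1) j" using assms by (subst move) auto
  also have "\<dots> = h (m - 1) j" by (rule h_eqI[where q = 1 and p = 0]) auto
  finally show ?thesis .
qed

text \<open>The sum \<open>i + j\<close> falls by 1 per step and meets no multiple of
  \<open>m\<close> before the end. The last hypothesis avoids column \<open>1\<close>: an even
  column is never \<open>1\<close> modulo the even \<open>m\<close>, and an odd one, starting at
  most at \<open>m\<close>, stays above \<open>1\<close> until the last point.\<close>

lemma run:
  assumes "0 \<le> n" "2 \<le> j" "j + n \<le> m - 1"
    and "n \<le> i + j \<and> i + j < m \<or> m + n \<le> i + j \<and> i + j < 2 * m"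
    and "even i \<or> 1 \<le> i - 2 * n \<and> i \<le> m"
  shows "h i j = h (i - 2 * n) (j + n)"
  using assms(1,3,4,5)
proof (induct n rule: int_ge_induct)
  case (step n)
  have "(i - 2 * n + (j + n)) mod m = (if i + j < m then i + j - n else i + j - n - m)"
    using step.prems step.hyps assms mod_pos_pos_trivial[of "i + j - n - m" m]
    by (auto simp: mod_pos_pos_trivial)
  then have sum: "(i - 2 * n + (j + n)) mod m \<noteq> 0"
    using step.prems step.hyps by auto
  have col: "(i - 2 * n) mod m \<noteq> 1"
  proof (cases "even i")
    case True
    then have "even ((i - 2 * n) mod m)" using m_even by (simp add: dvd_mod_iff)
    then show ?thesis by auto
  next
    case False
    then have "i \<noteq> m" using m_even by auto
    then show ?thesis using False step by (simp add: mod_pos_pos_trivial)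
  qed
  have "h (i - 2 * n) (j + n) = h (i - 2 * n - 2) (j + n + 1)"
    using step assms by (intro diag sum col) auto
  with step show ?case by (auto simp: algebra_simps)
qed simp

lemma top:
  assumes "3 \<le> i" "i < m"
  shows "h i (m - 1) = h (i - 3) 0"
proof -
  have "h i (m - 1) = h (i - 3) m" using assms by (subst move) auto
  also have "\<dots> = h (i - 3) 0" by (rule h_eqI[where q = 0 and p = "- 1"]) auto
  finally show ?thesis .
qed

lemma top_0: "h 0 (m - 1) = h (m - 3) 0"
proof -
  have "h 0 (m - 1) = h (- 3) m" using m_ge by (subst move) auto
  also have "\<dots> = h (m - 3) 0" by (rule h_eqI[where q = 1 and p = "- 1"]) auto
  finally show ?thesis .
qed

lemma row0_0: "h 0 0 = h (m - 3) 0"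
proof -
  have "h 0 0 = h (- 2) 2" using m_ge by (subst move) auto
  also have "\<dots> = h (m - 2) 2" by (rule h_eqI[where q = 1 and p = 0]) auto
  also have "\<dots> = h (m - 4) 2" using m_ge by (subst move) auto
  also have "\<dots> = h (2 - m) (m - 1)" using run[of "m - 3" 2 "m - 4"] m_ge m_even by (auto simp: algebra_simps)
  also have "\<dots> = h 2 (m - 1)" by (rule h_eqI[where q = 1 and p = 0]) auto
  also have "\<dots> = h 0 (m - 1)" using m_ge by (subst move) auto
  finally show ?thesis using top_0 by simp
qed

lemma row0_1: "h 1 0 = h (m - 2) 0"
proof -
  have "h 1 0 = h (- 2) 0" using m_ge by (subst move) auto
  also have "\<dots> = h (m - 2) 0" by (rule h_eqI[where q = 1 and p = 0]) auto
  finally show ?thesis .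
qed

lemma row0_2: "h 2 0 = h (m - 1) 0"
proof -
  have "h 2 0 = h (- 1) 0" using m_ge by (subst move) auto
  also have "\<dots> = h (m - 1) 0" by (rule h_eqI[where q = 1 and p = 0]) auto
  finally show ?thesis .
qed

lemma row1_0: "h 0 1 = h (m - 3) 2"
proof -
  have "h 0 1 = h (- 1) 1" using m_ge by (subst move) auto
  also have "\<dots> = h (m - 1) 1" by (rule h_eqI[where q = 1 and p = 0]) auto
  also have "\<dots> = h (m - 3) 2" using m_ge by (subst move) auto
  finally show ?thesis .
qed

lemma row1_m2: "h (m - 2) 1 = h (m - 5) 2"
proof -
  have "h (m - 2) 1 = h (m - 3) 1" using m_ge by (subst move) auto
  also have "\<dots> = h (m - 5) 2" using m_ge by (subst move) auto
  finally show ?thesis .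
qed

text \<open>The corrections are \<open>- 1\<close> on the antidiagonal, \<open>- 2\<close> in column
  \<open>1\<close> and \<open>- 1\<close> in row \<open>m - 1\<close>. An even path meets the
  antidiagonal first, whose odd shift sends it to odd columns and so to column \<open>1\<close>; for
  odd \<open>i\<close> the order is reversed.\<close>

lemma row0_even:
  assumes "even i" "4 \<le> i" "i \<le> m - 2"
  shows "h i 0 = h (i - 4) 0"
proof -
  obtain l where m: "m = 2 * l" "3 \<le> l" by (rule m_half)
  obtain k where k: "i = 2 * k" using assms by (auto elim: evenE)
  have "h i 0 = h (i - 2) 1" using assms by (subst move) auto
  also have "\<dots> = h (i - 4) 2" using assms by (subst move) auto
  also have "\<dots> = h (- i) i" using run[of "i - 2" 2 "i - 4"] assms by (auto simp: algebra_simps)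
  also have "\<dots> = h (- i - 1) i" using anti[of i "- i"] assms by auto
  also have "\<dots> = h (m - i - 1) i" by (rule h_eqI[where q = 1 and p = 0]) auto
  also have "\<dots> = h 1 (l + k - 1)"
    using run[of "l - k - 1" i "m - i - 1"] assms k m by (auto simp: algebra_simps)
  also have "\<dots> = h (m - 1) (l + k - 1)" using assms k m by (intro col1) auto
  also have "\<dots> = h (i - 1) (m - 1)"
    using run[of "l - k" "l + k - 1" "m - 1"] assms k m by (auto simp: algebra_simps)
  also have "\<dots> = h (i - 4) 0" using top[of "i - 1"] assms by simp
  finally show ?thesis .
qed

lemma row0_odd:
  assumes "odd i" "5 \<le> i" "i \<le> m - 1"
  shows "h i 0 = h (i - 4) 0"
proof -
  obtain l where m: "m = 2 * l" "3 \<le> l" by (rule m_half)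
  obtain k where k: "i = 2 * k + 1" using assms by (auto elim: oddE)
  have "h i 0 = h (i - 4) 2"
  proof (cases "i = m - 1")
    case True
    then have "h i 0 = h (m - 2) 1" using assms by (subst move) auto
    then show ?thesis using row1_m2 True by simp
  next
    case False
    then have "i \<le> m - 3" using assms m by presburger
    have "h i 0 = h (i - 2) 1" using assms \<open>i \<le> m - 3\<close> by (subst move) auto
    also have "\<dots> = h (i - 4) 2" using assms \<open>i \<le> m - 3\<close> by (subst move) auto
    finally show ?thesis .
  qed
  also have "\<dots> = h 1 k" using run[of "k - 2" 2 "i - 4"] assms k by (auto simp: algebra_simps)
  also have "\<dots> = h (m - 1) k" using assms k m by (intro col1) auto
  also have "\<dots> = h (m - i + 2) (i - 2)"
    using run[of "k - 1" k "m - 1"] assms k m by (auto simp: algebra_simps)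
  also have "\<dots> = h (m - i + 1) (i - 2)" using anti[of "i - 2" "m - i + 2"] assms by (auto simp: algebra_simps)
  also have "\<dots> = h (i - 1 - m) (m - 1)"
    using run[of "m + 1 - i" "i - 2" "m - i + 1"] assms m_even by (auto simp: algebra_simps)
  also have "\<dots> = h (i - 1) (m - 1)" by (rule h_eqI[where q = 1 and p = 0]) auto
  also have "\<dots> = h (i - 4) 0" using top[of "i - 1"] assms by simp
  finally show ?thesis .
qed

lemma row0_minus4:
  assumes "4 \<le> i" "i < m"
  shows "h i 0 = h (i - 4) 0"
proof -
  have "odd i \<and> 5 \<le> i \<and> i \<le> m - 1 \<or> even i \<and> 4 \<le> i \<and> i \<le> m - 2"
    using assms m_even by presburger
  then show ?thesis using row0_even row0_odd by auto
qed

lemma row0_mod4: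
  assumes "0 \<le> i" "i < m"
  shows "h i 0 = h (i mod 4) 0"
  using assms
proof (induct "nat i" arbitrary: i rule: less_induct)
  case less
  show ?case
  proof (cases "i < 4")
    case False
    then have "h (i - 4) 0 = h ((i - 4) mod 4) 0" using less.prems by (intro less.hyps) auto
    moreover have "(i - 4) mod 4 = i mod 4" by presburger
    ultimately show ?thesis using row0_minus4[of i] False less.prems by simp
  qed (use less.prems in auto)
qed

lemma row0_const: "h i 0 = h 0 0"
proof -
  have m4: "m mod 4 = 0 \<or> m mod 4 = 2" using m_even by presburger
  have "h 0 0 = h ((m - 3) mod 4) 0" using row0_mod4[of "m - 3"] row0_0 m_ge by simp
  moreover have "h 1 0 = h ((m - 2) mod 4) 0" using row0_mod4[of "m - 2"] row0_1 m_ge by simp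
  moreover have "h 2 0 = h ((m - 1) mod 4) 0" using row0_mod4[of "m - 1"] row0_2 m_ge by simp
  \<comment> \<open>The three links chain all four classes: in the order \<open>0, 1, 2, 3\<close>
    for \<open>m mod 4 = 0\<close> and \<open>2, 1, 0, 3\<close> for
    \<open>m mod 4 = 2\<close>.\<close>
  moreover have "m mod 4 = 0 \<Longrightarrow> (m - 3) mod 4 = 1 \<and> (m - 2) mod 4 = 2 \<and> (m - 1) mod 4 = 3"
    by presburger
  moreover have "m mod 4 = 2 \<Longrightarrow> (m - 3) mod 4 = 3 \<and> (m - 2) mod 4 = 0 \<and> (m - 1) mod 4 = 1"
    by presburger
  ultimately have "h 1 0 = h 0 0 \<and> h 2 0 = h 0 0 \<and> h 3 0 = h 0 0" using m4 by auto
  moreover have "h i 0 = h (i mod m mod 4) 0"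
    using row0_mod4[of "i mod m"] h_mod[of i 0 0 0] m_ge by simp
  moreover have "i mod m mod 4 = 0 \<or> i mod m mod 4 = 1 \<or> i mod m mod 4 = 2 \<or> i mod m mod 4 = 3"
    using pos_mod_bound[of 4 "i mod m"] pos_mod_sign[of 4 "i mod m"] by linarith
  ultimately show ?thesis by auto
qed

lemma climb:
  assumes "1 \<le> j" "j < m"
  shows "\<exists>i'. h i j = h i' (j + 1)"
proof -
  let ?i = "i mod m"
  have i: "0 \<le> ?i" "?i < m" and hi: "h i j = h ?i j" using m_ge h_mod[of i 0 j 0]
    h_mod[of ?i 0 j 0] by auto
  have "j = 1 \<or> j = 2 \<or> 3 \<le> j \<and> j < m - 1 \<or> j = m - 1" using assms by linarith
  then show ?thesis
  proof (elim disjE conjE)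
    assume j: "j = 1"
    have "h 1 1 = h 0 1" using m_ge by (subst move) auto
    moreover have "h ?i 1 = h (?i - 2) 2" if "?i \<noteq> 0" "?i \<noteq> 1" "?i \<noteq> m - 2"
      using that i m_ge by (subst move) auto
    ultimately show ?thesis using j hi row1_0 row1_m2 by (metis one_add_one)
  next
    assume j: "j = 2"
    have "h (m - 2) 2 = h (m - 4) 2" using m_ge by (subst move) auto
    then have "h (m - 2) 2 = h (m - 6) 3" using m_ge by (subst (asm) (2) move) auto
    moreover have "h (m - 1) 2 = h (m - 3) 3" using m_ge by (subst move) auto
    then have "h 1 2 = h (m - 3) 3" using col1[of 2] m_ge by simp
    moreover have "h ?i 2 = h (?i - 2) 3" if "?i \<noteq> m - 2" "?i \<noteq> 1"
      using that i m_ge by (subst move) auto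
    ultimately show ?thesis using j hi by (metis numeral_plus_one semiring_norm(5))
  next
    assume j: "3 \<le> j" "j < m - 1"
    have *: "\<exists>i'. h k j = h i' (j + 1)" if "0 \<le> k" "k < m" "k \<noteq> 1" "k + j \<noteq> m" for k
    proof -
      have "h k j = h (k - 2) (j + 1)" using that j by (subst move) auto
      then show ?thesis by blast
    qed
    \<comment> \<open>Column \<open>1\<close> first shifts within its row to column
      \<open>m - 1\<close>, which is off the antidiagonal as \<open>3 \<le> j\<close>.\<close>
    have col1': "\<exists>i'. h 1 j = h i' (j + 1)" using col1[of j] *[of "m - 1"] j by auto
    show ?thesis
    proof (cases "?i + j = m")
      case True
      then have "h ?i j = h (?i - 1) j" using i j by (subst move) auto
      then show ?thesis using hi True *[of "?i - 1"] col1' i j by (cases "?i = 2") auto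
    next
      case False
      then show ?thesis using hi *[of ?i] col1' i by (cases "?i = 1") auto
    qed
  next
    assume j: "j = m - 1"
    have "h 1 (m - 1) = h (m - 1) (m - 1)" using m_ge by (intro col1) auto
    then have "h 1 (m - 1) = h (m - 4) 0" using top[of "m - 1"] m_ge by simp
    moreover have "h 2 (m - 1) = h 0 (m - 1)" using m_ge by (subst move) auto
    moreover have "?i = 0 \<or> ?i = 1 \<or> ?i = 2 \<or> 3 \<le> ?i" using i by linarith
    ultimately have "\<exists>i'. h ?i (m - 1) = h i' 0" using top[of ?i] top_0 i by auto
    then show ?thesis using j hi period_j[of _ 0] by auto
  qed
qed

lemma const: "0 \<le> j \<Longrightarrow> j \<le> m \<Longrightarrow> h i j = h 0 0"
  by (rule const_if_climb[OF row0_const climb])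

end

section \<open>Colour 1\<close>

text \<open>For \<open>m mod 6 \<noteq> 4\<close> the return map to the column \<open>i = 0\<close> sends odd \<open>j\<close> to \<open>j + 1\<close> and even
  \<open>j\<close> to \<open>j + 5\<close>, up to exceptions near the ends. So even \<open>j\<close> advance by 6, which is where
  \<open>m mod 6\<close> matters: it decides which residue classes modulo 6 the exceptions join.\<close>

locale color1X_invariant = torus_invariant +
  assumes m_mod6: "m mod 6 = 0 \<or> m mod 6 = 2"
    and move: "\<And>i j. \<lbrakk>0 \<le> i; i < m; 0 \<le> j; j < m\<rbrakk> \<Longrightarrow> h i j =
    (if i = 0 \<and> j = 0 \<or> 1 \<le> i \<and> i \<le> m - 3 \<and> j = 1 \<or> m - 2 \<le> i \<and> j = 2 then h (i + 2) (j - 2)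
     else if i = 0 \<and> 2 \<le> j \<or> i = 1 \<and> j = 0 \<or> i = m - 2 \<and> j = 1 then h (i + 1) (j - 1)
     else h (i + 1) (j - 2))"
begin

lemma diag:
  assumes "1 \<le> i" "i < m" "j mod m \<noteq> 1" "i = 1 \<longrightarrow> j mod m \<noteq> 0" "i < m - 2 \<or> j mod m \<noteq> 2"
  shows "h i j = h (i + 1) (j - 2)"
proof -
  have "h i (j mod m) = h (i + 1) (j mod m - 2)" using assms m_ge by (subst move) auto
  then show ?thesis using h_mod[of i 0 j 0] h_mod[of i 1 j "- 2"] assms by simp
qed

text \<open>Before the last point the row is odd and at least \<open>3\<close>, so it meets neither
  row \<open>1\<close> nor the exceptional even rows \<open>0\<close> and \<open>2\<close>.\<close>

lemma run_odd:
  assumes "0 \<le> n" "odd j" "1 \<le> i" "i + n \<le> m" "1 \<le> j - 2 * n" "j < m"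
  shows "h i j = h (i + n) (j - 2 * n)"
  using assms(1,4,5)
proof (induct n rule: int_ge_induct)
  case (step n)
  have "h (i + n) (j - 2 * n) = h (i + n + 1) (j - 2 * n - 2)"
    using step assms by (intro diag) (auto simp: mod_pos_pos_trivial)
  with step show ?case by (auto simp: algebra_simps)
qed simp

text \<open>Even rows never meet row \<open>1\<close>, even modulo \<open>m\<close>. The run ends by
  column \<open>m - 2\<close>, the first of the two last columns where row \<open>2\<close> is
  exceptional.\<close>

lemma run_even:
  assumes "0 \<le> n" "even j" "2 \<le> i \<or> i = 1 \<and> j mod m \<noteq> 0" "i + n \<le> m - 2"
  shows "h i j = h (i + n) (j - 2 * n)"
  using assms(1,4)
proof (induct n rule: int_ge_induct)
  case (step n)
  have "even ((j - 2 * n) mod m)" using assms(2) m_even by (simp add: dvd_mod_iff)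
  then have "h (i + n) (j - 2 * n) = h (i + n + 1) (j - 2 * n - 2)"
    using step assms by (intro diag) auto
  with step show ?case by (auto simp: algebra_simps)
qed simp

lemma hit:
  assumes "1 \<le> i" "i \<le> m - 3"
  shows "h i 1 = h (i + 2) (m - 1)"
proof -
  have "h i 1 = h (i + 2) (- 1)" using assms by (subst move) auto
  also have "\<dots> = h (i + 2) (m - 1)" by (rule h_eqI[where q = 0 and p = 1]) auto
  finally show ?thesis .
qed

lemma col0_wrap: "h m j = h 0 j"
  using period_i[of 0 j] by simp

lemma col0_0: "h 0 0 = h 0 2"
proof -
  have "h 0 0 = h 2 (- 2)" using m_ge by (subst move) auto
  also have "\<dots> = h (m - 2) (6 - 2 * m)" using run_even[of "m - 4" "- 2" 2] m_ge by (auto simp: algebra_simps)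
  also have "\<dots> = h (m - 2) 6" by (rule h_eqI[where q = 0 and p = 2]) auto
  also have "\<dots> = h (m - 1) 4" using diag[of "m - 2" 6] m_ge by (cases "m = 6") auto
  also have "\<dots> = h 0 2" using diag[of "m - 1" 4] m_ge col0_wrap by auto
  finally show ?thesis .
qed

lemma col0_1: "h 0 1 = h 0 3"
proof -
  obtain l where m: "m = 2 * l" "3 \<le> l" by (rule m_half)
  have "h 0 1 = h 1 (- 1)" using m_ge by (subst move) auto
  also have "\<dots> = h 1 (m - 1)" by (rule h_eqI[where q = 0 and p = 1]) auto
  also have "\<dots> = h l 1" using run_odd[of "l - 1" "m - 1" 1] m by auto
  also have "\<dots> = h (l + 2) (m - 1)" using m by (intro hit) auto
  also have "\<dots> = h m 3" using run_odd[of "l - 2" "m - 1" "l + 2"] m by auto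
  finally show ?thesis by (simp add: col0_wrap)
qed

lemma col0_odd_run:
  assumes "odd j" "3 \<le> j" "j \<le> m - 1"
  shows "h 0 j = h (m - 2) (j + 5)"
proof -
  have "h 0 j = h 1 (j - 1)" using assms by (subst move) auto
  also have "\<dots> = h (m - 2) (j + 5 - 2 * m)"
    using run_even[of "m - 3" "j - 1" 1] assms by (auto simp: algebra_simps)
  also have "\<dots> = h (m - 2) (j + 5)" by (rule h_eqI[where q = 0 and p = 2]) auto
  finally show ?thesis .
qed

text \<open>Column \<open>0\<close> lowers \<open>j\<close> by 1 instead of 2 and thereby makes it
  even; even rows never meet row \<open>1\<close>, so this correction by 1 is the only one.\<close>

lemma col0_odd:
  assumes "odd j" "3 \<le> j" "j \<le> m - 5"
  shows "h 0 j = h 0 (j + 1)"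
proof -
  have "(j + 5) mod m = (if j + 5 = m then 0 else j + 5)"
    using assms by (auto intro: mod_pos_pos_trivial)
  then have "(j + 5) mod m \<noteq> 1" "(j + 5) mod m \<noteq> 2" using assms(2) by auto
  moreover have "(j + 3) mod m = j + 3" using assms by (intro mod_pos_pos_trivial) auto
  then have "(j + 3) mod m \<noteq> 1" "(j + 3) mod m \<noteq> 2" using assms(2) by auto
  moreover have "m - 2 \<noteq> 1" "m - 1 \<noteq> 1" "m - 2 + 1 = m - 1" "m - 1 + 1 = m"
    "j + 5 - 2 = j + 3" "j + 3 - 2 = j + 1" using m_ge by auto
  ultimately have "h (m - 2) (j + 5) = h (m - 1) (j + 3)" "h (m - 1) (j + 3) = h m (j + 1)"
    using diag[of "m - 2" "j + 5"] diag[of "m - 1" "j + 3"] assms(2,3) by (auto simp: add.commute)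
  then show ?thesis using col0_odd_run[of j] assms by (simp add: col0_wrap)
qed

lemma col0_m3: "h 0 (m - 3) = h 0 0"
proof -
  have "h 0 (m - 3) = h (m - 2) (m - 3 + 5)" using m_ge m_even by (intro col0_odd_run) auto
  also have "\<dots> = h (m - 2) 2" by (rule h_eqI[where q = 0 and p = "- 1"]) auto
  also have "\<dots> = h m 0" using m_ge by (subst move) auto
  finally show ?thesis by (simp add: col0_wrap)
qed

lemma h_1_0: 
  assumes "8 \<le> m"
  shows "h 1 0 = h 0 5"
proof -
  obtain l where m: "m = 2 * l" "3 \<le> l" by (rule m_half)
  have "h 1 0 = h 2 (- 1)" using m_ge by (subst move) auto
  also have "\<dots> = h 2 (m - 1)" by (rule h_eqI[where q = 0 and p = 1]) auto
  also have "\<dots> = h (l + 1) 1" using run_odd[of "l - 1" "m - 1" 2] m by (auto simp: add.commute)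
  also have "\<dots> = h (l + 3) (m - 1)" using hit[of "l + 1"] m assms by (auto simp: add.commute)
  also have "\<dots> = h m 5" using run_odd[of "l - 3" "m - 1" "l + 3"] m by auto
  finally show ?thesis by (simp add: col0_wrap)
qed

lemma h_m1_2: "h (m - 1) 2 = h 1 0"
proof -
  have "h (m - 1) 2 = h (m + 1) 0" using m_ge by (subst move) (auto simp: add.commute)
  also have "\<dots> = h 1 0" by (rule h_eqI[where q = "- 1" and p = 0]) auto
  finally show ?thesis .
qed

lemma col0_m1: "h 0 (m - 1) = h 1 0"
proof -
  have "h 0 (m - 1) = h (m - 2) (m - 1 + 5)" using m_ge m_even by (intro col0_odd_run) auto
  also have "\<dots> = h (m - 2) 4" by (rule h_eqI[where q = 0 and p = "- 1"]) auto
  also have "\<dots> = h (m - 1) 2" using m_ge by (subst move) auto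
  finally show ?thesis by (simp add: h_m1_2)
qed

lemma col0_even_run:
  assumes "1 \<le> k" "2 * k \<le> m - 2"
  shows "h 0 (2 * k) = h (k + 2) (m - 1)"
proof -
  have "h 0 (2 * k) = h 1 (2 * k - 1)" using assms by (subst move) auto
  also have "\<dots> = h k 1" using run_odd[of "k - 1" "2 * k - 1" 1] assms by auto
  also have "\<dots> = h (k + 2) (m - 1)" using assms m_ge by (intro hit) auto
  finally show ?thesis .
qed

lemma col0_even_run2:
  assumes "1 \<le> k" "2 * k \<le> m - 4" "m = 2 * l"
  shows "h 0 (2 * k) = h (k + l + 1) 1"
  using col0_even_run[of k] run_odd[of "l - 1" "m - 1" "k + 2"] assms
  by (auto simp: algebra_simps)

text \<open>After column \<open>0\<close>, which contributes 1, the path keeps to odd rows and meets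
  row \<open>1\<close> twice. Each time it crosses two columns while \<open>j\<close> drops by 2
  instead of 4, so the total shift is \<open>1 + 2 + 2\<close>.\<close>

lemma col0_even:
  assumes "even j" "2 \<le> j" "j \<le> m - 8"
  shows "h 0 j = h 0 (j + 5)"
proof -
  obtain l where m: "m = 2 * l" "3 \<le> l" by (rule m_half)
  obtain k where k: "j = 2 * k" using assms by (auto elim: evenE)
  have "h 0 j = h (k + l + 1) 1" using col0_even_run2[of k l] assms k m by auto
  also have "\<dots> = h (k + l + 3) (m - 1)" using hit[of "k + l + 1"] assms k m by (auto simp: algebra_simps)
  also have "\<dots> = h m (j + 5)"
    using run_odd[of "l - 3 - k" "m - 1" "k + l + 3"] assms k m by (auto simp: algebra_simps)
  finally show ?thesis by (simp add: col0_wrap)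
qed

lemma col0_m6:
  assumes "8 \<le> m"
  shows "h 0 (m - 6) = h 0 (m - 2)"
proof -
  obtain l where m: "m = 2 * l" "3 \<le> l" by (rule m_half)
  have "h 0 (m - 6) = h (m - 2) 1" using col0_even_run2[of "l - 3" l] assms m by auto
  also have "\<dots> = h (m - 1) 0" using m by (subst move) auto
  also have "\<dots> = h m (- 2)" using m by (subst move) auto
  also have "\<dots> = h 0 (m - 2)" by (rule h_eqI[where q = "- 1" and p = 1]) auto
  finally show ?thesis .
qed

lemma col0_m4: "h 0 (m - 4) = h 0 (m - 1)"
proof -
  obtain l where m: "m = 2 * l" "3 \<le> l" by (rule m_half)
  have "h 0 (m - 4) = h (m - 1) 1" using col0_even_run2[of "l - 2" l] m by auto
  also have "\<dots> = h m (- 1)" using m by (subst move) auto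
  also have "\<dots> = h 0 (m - 1)" by (rule h_eqI[where q = "- 1" and p = 1]) auto
  finally show ?thesis .
qed

lemma col0_m2: "h 0 (m - 2) = h 0 1"
proof -
  obtain l where m: "m = 2 * l" "3 \<le> l" by (rule m_half)
  have "h 0 (m - 2) = h (l + 1) (m - 1)" using col0_even_run[of "l - 1"] m by (auto simp: add.commute)
  also have "\<dots> = h m 1" using run_odd[of "l - 1" "m - 1" "l + 1"] m by auto
  finally show ?thesis by (simp add: col0_wrap)
qed

lemma col0_plus6:
  assumes "even j" "2 \<le> j" "j \<le> m - 10"
  shows "h 0 j = h 0 (j + 6)"
  using col0_even[of j] col0_odd[of "j + 5"] assms by (simp add: add.assoc)

lemma col0_mod6:
  assumes "0 \<le> n" "even r" "2 \<le> r" "r + 6 * n \<le> m - 4"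
  shows "h 0 r = h 0 (r + 6 * n)"
  using assms(1,4)
proof (induct n rule: int_ge_induct)
  case (step n)
  then show ?case using col0_plus6[of "r + 6 * n"] assms by (simp add: algebra_simps)
qed simp

text \<open>For \<open>m = 6\<close> and \<open>m = 8\<close> there is no room for an advance by 6.
  Otherwise \<open>m - 8\<close> and \<open>m - 4\<close> lie in the progressions of
  \<open>4\<close> and \<open>2\<close> (first form) or of \<open>6\<close> and \<open>4\<close>
  (second form).\<close>

lemma m_cases: obtains "m = 6" | "m = 8" | q where "m = 12 + 6 * q" "0 \<le> q" | q where "m = 14 + 6 * q" "0 \<le> q"
proof -
  have "m = 6 \<or> m = 8 \<or> m = 12 + 6 * (m div 6 - 2) \<and> 0 \<le> m div 6 - 2
      \<or> m = 14 + 6 * (m div 6 - 2) \<and> 0 \<le> m div 6 - 2"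
    using m_mod6 m_ge by presburger
  then show ?thesis using that by blast
qed

text \<open>Two links join the progressions of even rows: \<open>m - 8\<close> leads through
  \<open>m - 3\<close> to \<open>0\<close> and so to \<open>2\<close>, while \<open>m - 4\<close>
  leads through \<open>m - 1\<close>, the point \<open>(1, 0)\<close> and row \<open>5\<close> to
  \<open>6\<close>. Which progressions end in \<open>m - 8\<close> and \<open>m - 4\<close> depends
  on \<open>m mod 6\<close>.\<close>

lemma col0_base: "h 0 2 = h 0 0 \<and> (m > 6 \<longrightarrow> h 0 4 = h 0 0 \<and> h 0 6 = h 0 0)"
proof (cases rule: m_cases)
  case 1
  then show ?thesis using col0_0 by simp
next
  case 2
  then show ?thesis using col0_0 col0_1 col0_m2 col0_m6 col0_m4 col0_m1 h_1_0 col0_m3 col0_odd[of 3]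
    by simp
next
  case (3 q)
  have "h 0 4 = h 0 (m - 8)" using col0_mod6[of q 4] 3 by simp
  moreover have "h 0 (m - 8) = h 0 (m - 3)" using col0_even[of "m - 8"] 3 m_even by simp
  moreover have "h 0 2 = h 0 (m - 4)" using col0_mod6[of "q + 1" 2] 3 by simp
  moreover have "h 0 5 = h 0 6" using col0_odd[of 5] 3 by simp
  ultimately show ?thesis using col0_0 col0_m3 col0_m4 col0_m1 h_1_0 3 by simp
next
  case (4 q)
  have "h 0 6 = h 0 (m - 8)" using col0_mod6[of q 6] 4 by simp
  moreover have "h 0 (m - 8) = h 0 (m - 3)" using col0_even[of "m - 8"] 4 m_even by simp
  moreover have "h 0 4 = h 0 (m - 4)" using col0_mod6[of "q + 1" 4] 4 by simp
  moreover have "h 0 5 = h 0 6" using col0_odd[of 5] 4 by simp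
  ultimately show ?thesis using col0_0 col0_m3 col0_m4 col0_m1 h_1_0 4 by simp
qed

lemma col0_even_const:
  assumes "even j" "0 \<le> j" "j \<le> m - 4"
  shows "h 0 j = h 0 0"
proof (cases "j = 0")
  case False
  define r where "r = 2 + (j - 2) mod 6"
  have "r = 2 \<or> r = 4 \<or> r = 6"
    using assms(1) unfolding r_def by presburger
  moreover have j: "j = r + 6 * ((j - 2) div 6)" unfolding r_def by simp
  have "0 \<le> (j - 2) div 6" using assms False by (simp add: pos_imp_zdiv_nonneg_iff) presburger
  moreover from this have "r \<le> j" using j by linarith
  ultimately show ?thesis
    using col0_mod6[of "(j - 2) div 6" r] j col0_base assms m_ge by (cases "m = 6") auto
qed simp

lemma col0_const:
  assumes "0 \<le> j" "j < m"
  shows "h 0 j = h 0 0"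
proof -
  have 1: "h 0 1 = h 0 0"
  proof (cases "m = 6")
    case True
    then show ?thesis using col0_m3 col0_1 by simp
  next
    case False
    then show ?thesis using col0_1 col0_odd[of 3] col0_even_const[of 4] m_ge m_even col0_base
      by (cases "m = 8") auto
  qed
  have "even j \<and> j \<le> m - 4 \<or> j = m - 2 \<or> j = 1 \<or> odd j \<and> 3 \<le> j \<and> j \<le> m - 5 \<or> j = m - 3 \<or> j = m - 1"
    using assms m_even by presburger
  then show ?thesis
    using assms 1 col0_even_const[of j] col0_m2 col0_odd[of j] col0_even_const[of "j + 1"]
      col0_m3 col0_m4 col0_even_const[of "m - 4"] m_even m_ge by auto
qed

lemma advance:
  assumes "1 \<le> i" "i < m"
  shows "\<exists>i' j'. h i j = h i' j' \<and> (i' = 0 \<or> i < i' \<and> i' \<le> m)"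
proof -
  obtain k where k: "0 \<le> k" "k < m" "h i j = h i k"
    using h_mod_j[of i j] m_ge by (metis pos_mod_bound pos_mod_sign zero_less_numeral less_le_trans)
  show ?thesis
  proof (cases "i = m - 1 \<and> k = 2")
    \<comment> \<open>The only move that skips column \<open>m\<close>: it reaches column
      \<open>m + 1\<close> at \<open>(1, 0)\<close>, whose value also occurs in column
      \<open>0\<close>.\<close>
    case True
    have "h (m - 1) 2 = h 0 (m - 1)" using h_m1_2 col0_m1 by simp
    then show ?thesis using k True by metis
  next
    case False
    have "h i k = (if i \<le> m - 3 \<and> k = 1 \<or> i = m - 2 \<and> k = 2 then h (i + 2) (k - 2)
        else if i = 1 \<and> k = 0 \<or> i = m - 2 \<and> k = 1 then h (i + 1) (k - 1)
        else h (i + 1) (k - 2))"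
      using assms False k by (subst move) auto
    then have "h i k = h (i + 1) (k - 1) \<or> h i k = h (i + 1) (k - 2)
        \<or> h i k = h (i + 2) (k - 2) \<and> i + 2 \<le> m"
      by (auto split: if_splits)
    moreover have "i < i + 1" "i + 1 \<le> m" "i < i + 2" using assms by auto
    ultimately show ?thesis using k(3) by metis
  qed
qed

lemma const: "0 \<le> i \<Longrightarrow> i \<le> m \<Longrightarrow> h i j = h 0 0"
proof (rule const_if_advance[OF _ advance])
  show "h 0 j = h 0 0" for j using col0_const[of "j mod m"] h_mod_j[of 0 j] m_ge by simp
qed

end

text \<open>For \<open>m mod 6 = 4\<close> the return map to the column \<open>i = 0\<close> sends even \<open>j\<close> to \<open>j + 2\<close> and odd
  \<open>j\<close> to \<open>j + 6\<close>, again up to exceptions near the ends.\<close>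

locale color1Y_invariant = torus_invariant +
  assumes m_mod6: "m mod 6 = 4"
    and move: "\<And>i j. \<lbrakk>0 \<le> i; i < m; 0 \<le> j; j < m\<rbrakk> \<Longrightarrow> h i j =
    (if i = 0 \<and> j = 0 \<or> 2 \<le> i \<and> i \<le> m - 3 \<and> j = 1 \<or> m - 2 \<le> i \<and> j = 2 \<or> i = 1 \<and> j = m - 1
     then h (i + 2) (j - 2)
     else if i = 0 \<and> 2 \<le> j \<or> i = 1 \<or> i = 2 \<and> (j = 0 \<or> j = m - 1) \<or> i = m - 2 \<and> j = 1
     then h (i + 1) (j - 1)
     else h (i + 1) (j - 2))"
begin

lemma m_form: obtains q where "m = 10 + 6 * q" "0 \<le> q"
proof -
  have "m = 10 + 6 * (m div 6 - 1) \<and> 0 \<le> m div 6 - 1" using m_mod6 m_ge by presburger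
  then show ?thesis using that by blast
qed

lemma m_ge10: "10 \<le> m"
  using m_mod6 m_ge by presburger

lemma m_half5: obtains l where "m = 2 * l" "5 \<le> l"
proof -
  obtain l where "m = 2 * l" "3 \<le> l" by (rule m_half)
  then show ?thesis using that m_ge10 by auto
qed

lemma diag:
  assumes "2 \<le> i" "i < m" "j mod m \<noteq> 1" "i = 2 \<longrightarrow> j mod m \<noteq> 0 \<and> j mod m \<noteq> m - 1"
    and "i < m - 2 \<or> j mod m \<noteq> 2"
  shows "h i j = h (i + 1) (j - 2)"
proof -
  have "h i (j mod m) = h (i + 1) (j mod m - 2)" using assms m_ge by (subst move) auto
  then show ?thesis using h_mod[of i 0 j 0] h_mod[of i 1 j "- 2"] assms by simp
qed

lemma run_odd:
  assumes "0 \<le> n" "odd j" "2 \<le> i" "i = 2 \<longrightarrow> j < m - 1" "i + n \<le> m" "1 \<le> j - 2 * n" "j < m"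
  shows "h i j = h (i + n) (j - 2 * n)"
  using assms(1,5,6)
proof (induct n rule: int_ge_induct)
  case (step n)
  have "h (i + n) (j - 2 * n) = h (i + n + 1) (j - 2 * n - 2)"
    using step assms by (intro diag) (auto simp: mod_pos_pos_trivial)
  with step show ?case by (auto simp: algebra_simps)
qed simp

lemma run_even:
  assumes "0 \<le> n" "even j" "3 \<le> i" "i + n \<le> m - 2"
  shows "h i j = h (i + n) (j - 2 * n)"
  using assms(1,4)
proof (induct n rule: int_ge_induct)
  case (step n)
  have "even ((j - 2 * n) mod m)" using assms(2) m_even by (simp add: dvd_mod_iff)
  then have "(j - 2 * n) mod m \<noteq> 1" "(j - 2 * n) mod m \<noteq> m - 1" using m_even by auto
  then have "h (i + n) (j - 2 * n) = h (i + n + 1) (j - 2 * n - 2)"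
    using step assms by (intro diag) auto
  with step show ?case by (auto simp: algebra_simps)
qed simp

lemma hit:
  assumes "2 \<le> i" "i \<le> m - 3"
  shows "h i 1 = h (i + 2) (m - 1)"
proof -
  have "h i 1 = h (i + 2) (- 1)" using assms by (subst move) auto
  also have "\<dots> = h (i + 2) (m - 1)" by (rule h_eqI[where q = 0 and p = 1]) auto
  finally show ?thesis .
qed

lemma col0_wrap: "h m j = h 0 j"
  using period_i[of 0 j] by simp

lemma col0_0: "h 0 0 = h 0 2"
proof -
  have "h 0 0 = h 2 (- 2)" using m_ge by (subst move) auto
  also have "\<dots> = h 2 (m - 2)" by (rule h_eqI[where q = 0 and p = 1]) auto
  also have "\<dots> = h 3 (m - 4)" using m_ge10 by (subst move) auto
  also have "\<dots> = h (m - 2) (6 - m)"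
    using run_even[of "m - 5" "m - 4" 3] m_ge m_even by (auto simp: algebra_simps)
  also have "\<dots> = h (m - 2) 6" by (rule h_eqI[where q = 0 and p = 1]) auto
  also have "\<dots> = h (m - 1) 4" using m_ge10 by (subst move) auto
  also have "\<dots> = h m 2" using m_ge10 by (subst move) auto
  finally show ?thesis by (simp add: col0_wrap)
qed

lemma col0_1: "h 0 1 = h 0 5"
proof -
  obtain l where m: "m = 2 * l" "5 \<le> l" by (rule m_half5)
  have "h 0 1 = h 1 (- 1)" using m_ge by (subst move) auto
  also have "\<dots> = h 1 (m - 1)" by (rule h_eqI[where q = 0 and p = 1]) auto
  also have "\<dots> = h 3 (m - 3)" using m_ge by (subst move) auto
  also have "\<dots> = h (l + 1) 1" using run_odd[of "l - 2" "m - 3" 3] m by (auto simp: add.commute)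
  also have "\<dots> = h (l + 3) (m - 1)" using hit[of "l + 1"] m by (auto simp: add.commute)
  also have "\<dots> = h m 5" using run_odd[of "l - 3" "m - 1" "l + 3"] m by auto
  finally show ?thesis by (simp add: col0_wrap)
qed

lemma col0_to_col2:
  assumes "3 \<le> j" "j \<le> m - 1"
  shows "h 0 j = h 2 (j - 2)"
proof -
  have "h 0 j = h 1 (j - 1)" using assms by (subst move) auto
  also have "\<dots> = h 2 (j - 2)" using assms by (subst move) auto
  finally show ?thesis .
qed

lemma col0_even_run:
  assumes "even j" "4 \<le> j" "j \<le> m - 2"
  shows "h 0 j = h (m - 2) (j + 6)"
proof -
  have "h 2 (j - 2) = h 3 (j - 4)" using assms m_ge10 by (subst move) auto
  also have "\<dots> = h (m - 2) (j + 6 - 2 * m)"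
    using run_even[of "m - 5" "j - 4" 3] assms m_ge10 by (auto simp: algebra_simps)
  also have "\<dots> = h (m - 2) (j + 6)" by (rule h_eqI[where q = 0 and p = 2]) auto
  finally show ?thesis using col0_to_col2[of j] assms by simp
qed

lemma col0_even:
  assumes "even j" "4 \<le> j" "j \<le> m - 6"
  shows "h 0 j = h 0 (j + 2)"
proof -
  have "(j + 6) mod m = (if j + 6 = m then 0 else j + 6)"
    using assms by (auto intro: mod_pos_pos_trivial)
  then have "(j + 6) mod m \<noteq> 1" "(j + 6) mod m \<noteq> 2" using assms(2) by auto
  then have "h (m - 2) (j + 6) = h (m - 1) (j + 4)"
    using diag[of "m - 2" "j + 6"] m_ge by (auto simp: add.commute)
  also have "\<dots> = h m (j + 2)" using assms by (subst move) (auto simp: add.commute)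
  finally show ?thesis using col0_even_run[of j] assms by (simp add: col0_wrap)
qed

lemma col0_m4: "h 0 (m - 4) = h 0 0"
proof -
  have "h 0 (m - 4) = h (m - 2) (m - 4 + 6)" using m_ge10 m_even by (intro col0_even_run) auto
  also have "\<dots> = h (m - 2) 2" by (rule h_eqI[where q = 0 and p = "- 1"]) auto
  also have "\<dots> = h m 0" using m_ge by (subst move) auto
  finally show ?thesis by (simp add: col0_wrap)
qed

lemma h_1_0: "h 1 0 = h 0 4"
proof -
  have "h 1 0 = h 2 (- 1)" using m_ge by (subst move) auto
  also have "\<dots> = h 2 (m - 1)" by (rule h_eqI[where q = 0 and p = 1]) auto
  also have "\<dots> = h 3 (m - 2)" using m_ge by (subst move) auto
  also have "\<dots> = h (m - 2) (8 - m)"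
    using run_even[of "m - 5" "m - 2" 3] m_ge m_even by (auto simp: algebra_simps)
  also have "\<dots> = h (m - 2) 8" by (rule h_eqI[where q = 0 and p = 1]) auto
  also have "\<dots> = h (m - 1) 6" using m_ge10 by (subst move) auto
  also have "\<dots> = h m 4" using m_ge10 by (subst move) auto
  finally show ?thesis by (simp add: col0_wrap)
qed

lemma h_m1_2: "h (m - 1) 2 = h 1 0"
proof -
  have "h (m - 1) 2 = h (m + 1) 0" using m_ge by (subst move) (auto simp: add.commute)
  also have "\<dots> = h 1 0" by (rule h_eqI[where q = "- 1" and p = 0]) auto
  finally show ?thesis .
qed

lemma col0_m2: "h 0 (m - 2) = h 0 4"
proof -
  have "h 0 (m - 2) = h (m - 2) (m - 2 + 6)" using m_ge m_even by (intro col0_even_run) auto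
  also have "\<dots> = h (m - 2) 4" by (rule h_eqI[where q = 0 and p = "- 1"]) auto
  also have "\<dots> = h (m - 1) 2" using m_ge by (subst move) auto
  finally show ?thesis by (simp add: h_m1_2 h_1_0)
qed

lemma col0_odd_run:
  assumes "1 \<le> k" "2 * k \<le> m - 2"
  shows "h 0 (2 * k + 1) = h (k + 3) (m - 1)"
proof -
  have "h 0 (2 * k + 1) = h 2 (2 * k - 1)" using col0_to_col2[of "2 * k + 1"] assms by simp
  also have "\<dots> = h (k + 1) 1" using run_odd[of "k - 1" "2 * k - 1" 2] assms by (auto simp: add.commute)
  also have "\<dots> = h (k + 3) (m - 1)" using hit[of "k + 1"] assms m_ge10 by (auto simp: add.commute)
  finally show ?thesis .
qed

lemma col0_odd_run2:
  assumes "1 \<le> k" "2 * k \<le> m - 4" "m = 2 * l"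
  shows "h 0 (2 * k + 1) = h (k + l + 2) 1"
proof -
  have "h 0 (2 * k + 1) = h (k + 3) (m - 1)" using assms by (intro col0_odd_run) auto
  also have "\<dots> = h (k + l + 2) 1"
    using run_odd[of "l - 1" "m - 1" "k + 3"] assms m_ge10 by (auto simp: algebra_simps)
  finally show ?thesis .
qed

text \<open>Columns \<open>0\<close> and \<open>1\<close> contribute 1 each and together keep the
  parity of \<open>j\<close>, so here it is the odd rows that meet row \<open>1\<close>; two
  meetings at 2 each complete the 6.\<close>

lemma col0_plus6:
  assumes "odd j" "3 \<le> j" "j \<le> m - 9"
  shows "h 0 j = h 0 (j + 6)"
proof -
  obtain l where m: "m = 2 * l" "5 \<le> l" by (rule m_half5)
  obtain k where k: "j = 2 * k + 1" using assms by (auto elim: oddE)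
  have "h 0 j = h (k + l + 2) 1" using col0_odd_run2[of k l] assms k m by auto
  also have "\<dots> = h (k + l + 4) (m - 1)" using hit[of "k + l + 2"] assms k m by (auto simp: algebra_simps)
  also have "\<dots> = h m (j + 6)"
    using run_odd[of "l - 4 - k" "m - 1" "k + l + 4"] assms k m by (auto simp: algebra_simps)
  finally show ?thesis by (simp add: col0_wrap)
qed

lemma col0_m7: "h 0 (m - 7) = h 0 (m - 2)"
proof -
  obtain l where m: "m = 2 * l" "5 \<le> l" by (rule m_half5)
  have "h 0 (m - 7) = h (m - 2) 1" using col0_odd_run2[of "l - 4" l] m by auto
  also have "\<dots> = h (m - 1) 0" using m by (subst move) auto
  also have "\<dots> = h m (- 2)" using m by (subst move) auto
  also have "\<dots> = h 0 (m - 2)" by (rule h_eqI[where q = "- 1" and p = 1]) auto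
  finally show ?thesis .
qed

lemma col0_m5: "h 0 (m - 5) = h 0 (m - 1)"
proof -
  obtain l where m: "m = 2 * l" "5 \<le> l" by (rule m_half5)
  have "h 0 (m - 5) = h (m - 1) 1" using col0_odd_run2[of "l - 3" l] m by auto
  also have "\<dots> = h m (- 1)" using m by (subst move) auto
  also have "\<dots> = h 0 (m - 1)" by (rule h_eqI[where q = "- 1" and p = 1]) auto
  finally show ?thesis .
qed

lemma col0_m3: "h 0 (m - 3) = h 0 1"
proof -
  obtain l where m: "m = 2 * l" "5 \<le> l" by (rule m_half5)
  have "h 0 (m - 3) = h m 1" using col0_odd_run2[of "l - 2" l] m by auto
  then show ?thesis by (simp add: col0_wrap)
qed

lemma col0_m1: "h 0 (m - 1) = h 0 3"
proof -
  obtain l where m: "m = 2 * l" "5 \<le> l" by (rule m_half5)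
  have "h 0 (m - 1) = h (l + 2) (m - 1)" using col0_odd_run[of "l - 1"] m by (auto simp: add.commute)
  also have "\<dots> = h m 3" using run_odd[of "l - 2" "m - 1" "l + 2"] m by auto
  finally show ?thesis by (simp add: col0_wrap)
qed

lemma col0_even_const:
  assumes "even j" "0 \<le> j" "j < m"
  shows "h 0 j = h 0 0"
proof -
  have *: "h 0 4 = h 0 (4 + 2 * n)" if "0 \<le> n" "4 + 2 * n \<le> m - 4" for n
    using that
  proof (induct n rule: int_ge_induct)
    case (step n)
    then show ?case using col0_even[of "4 + 2 * n"] by (simp add: algebra_simps)
  qed simp
  obtain l where m: "m = 2 * l" "5 \<le> l" by (rule m_half5)
  have 4: "h 0 4 = h 0 0" using *[of "l - 4"] col0_m4 m by simp
  obtain k where k: "j = 2 * k" using assms by (auto elim: evenE)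
  have "k = 0 \<or> k = 1 \<or> k = l - 1 \<or> 2 \<le> k \<and> k \<le> l - 2" using assms k m by linarith
  then show ?thesis using *[of "k - 2"] 4 col0_0 col0_m2 k m by auto
qed

lemma col0_mod6:
  assumes "0 \<le> n" "odd r" "3 \<le> r" "r + 6 * n \<le> m - 3"
  shows "h 0 r = h 0 (r + 6 * n)"
  using assms(1,4)
proof (induct n rule: int_ge_induct)
  case (step n)
  then show ?case using col0_plus6[of "r + 6 * n"] assms by (simp add: algebra_simps)
qed simp

text \<open>As \<open>m = 10 + 6 * q\<close>, the progressions from \<open>3\<close>,
  \<open>5\<close> and \<open>7\<close> end in \<open>m - 7\<close>, \<open>m - 5\<close> and
  \<open>m - 3\<close>. From there one comes to the even row \<open>m - 2\<close>, through
  \<open>m - 1\<close> to \<open>3\<close>, and through \<open>1\<close> to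
  \<open>5\<close>.\<close>

lemma col0_base: "h 0 1 = h 0 0" "h 0 3 = h 0 0" "h 0 5 = h 0 0" "h 0 7 = h 0 0"
proof -
  obtain q where q: "m = 10 + 6 * q" "0 \<le> q" by (rule m_form)
  have 2: "h 0 (m - 2) = h 0 0" using col0_even_const[of "m - 2"] m_even m_ge by simp
  have 7: "h 0 7 = h 0 (m - 3)" using col0_mod6[of q 7] q by simp
  show "h 0 3 = h 0 0" using col0_mod6[of q 3] q col0_m7 2 by simp
  then show "h 0 5 = h 0 0" using col0_mod6[of q 5] q col0_m5 col0_m1 by simp
  then show "h 0 1 = h 0 0" using col0_1 by simp
  then show "h 0 7 = h 0 0" using 7 col0_m3 by simp
qed

lemma col0_const:
  assumes "0 \<le> j" "j < m"
  shows "h 0 j = h 0 0"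
proof -
  have "even j \<or> j = 1 \<or> j = m - 1 \<or> odd j \<and> 3 \<le> j \<and> j \<le> m - 3"
    using assms m_even by presburger
  then consider "even j" | "j = 1" | "j = m - 1" | "odd j" "3 \<le> j" "j \<le> m - 3" by blast
  then show ?thesis
  proof cases
    case 4
    define r where "r = 3 + (j - 3) mod 6"
    have "r = 3 \<or> r = 5 \<or> r = 7" using 4(1) unfolding r_def by presburger
    moreover have j: "j = r + 6 * ((j - 3) div 6)" unfolding r_def by simp
    have "0 \<le> (j - 3) div 6" using 4 by (simp add: pos_imp_zdiv_nonneg_iff)
    ultimately show ?thesis
      using col0_mod6[of "(j - 3) div 6" r] j col0_base 4 by auto
  qed (use col0_even_const[of j] assms col0_base col0_m1 in auto)
qed

lemma advance:
  assumes "1 \<le> i" "i < m"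
  shows "\<exists>i' j'. h i j = h i' j' \<and> (i' = 0 \<or> i < i' \<and> i' \<le> m)"
proof -
  obtain k where k: "0 \<le> k" "k < m" "h i j = h i k"
    using h_mod_j[of i j] m_ge by (metis pos_mod_bound pos_mod_sign zero_less_numeral less_le_trans)
  show ?thesis
  proof (cases "i = m - 1 \<and> k = 2")
    case True
    have "h (m - 1) 2 = h 0 4" using h_m1_2 h_1_0 by simp
    then show ?thesis using k True by metis
  next
    case False
    have "h i k = (if 2 \<le> i \<and> i \<le> m - 3 \<and> k = 1 \<or> i = m - 2 \<and> k = 2 \<or> i = 1 \<and> k = m - 1
        then h (i + 2) (k - 2)
        else if i = 1 \<or> i = 2 \<and> (k = 0 \<or> k = m - 1) \<or> i = m - 2 \<and> k = 1 then h (i + 1) (k - 1)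
        else h (i + 1) (k - 2))"
      using assms False k by (subst move) auto
    then have "h i k = h (i + 1) (k - 1) \<or> h i k = h (i + 1) (k - 2)
        \<or> h i k = h (i + 2) (k - 2) \<and> i + 2 \<le> m"
      using m_ge by (auto split: if_splits)
    moreover have "i < i + 1" "i + 1 \<le> m" "i < i + 2" using assms by auto
    ultimately show ?thesis using k(3) by metis
  qed
qed

lemma const: "0 \<le> i \<Longrightarrow> i \<le> m \<Longrightarrow> h i j = h 0 0"
proof (rule const_if_advance[OF _ advance])
  show "h 0 j = h 0 0" for j using col0_const[of "j mod m"] h_mod_j[of 0 j] m_ge by simp
qed

end

section \<open>Cyclic permutations and Hamilton cycles\<close>

text \<open>Not immediate, as \<open>orbit f v\<close> starts at \<open>f v\<close>. Restricting
  \<open>f\<close> to \<open>A\<close> gives a permutation of the whole type with finite support and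
  the same orbits inside \<open>A\<close>.\<close>

lemma bij_betw_self_in_orbit:
  assumes "finite A" "bij_betw f A A" "v \<in> A"
  shows "v \<in> orbit f v"
proof -
  have "perm_restrict f A permutes A"
    using assms(2) by (intro bij_imp_permutes) (auto simp: perm_restrict_def cong: bij_betw_cong)
  then have "v \<in> orbit (perm_restrict f A) v"
    using assms(1) by (intro permutation_self_in_orbit) (auto simp: permutation_permutes)
  also have "orbit (perm_restrict f A) v = orbit f v"
    using assms by (intro orbit_cong0[where A = A]) (auto simp: perm_restrict_def bij_betw_def)
  finally show ?thesis .
qed

text \<open>The orbit map \<open>orbit f\<close> is itself invariant, so invariants with values in
  \<open>'a set\<close> suffice.\<close>

lemma cyclic_on_if_invariants_const:
  fixes f :: "'a \<Rightarrow> 'a"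
  assumes "finite A" "bij_betw f A A" "a \<in> A"
    and const: "\<And>H :: 'a \<Rightarrow> 'a set. (\<And>v. v \<in> A \<Longrightarrow> H (f v) = H v) \<Longrightarrow> \<forall>v \<in> A. H v = H a"
  shows "cyclic_on f A"
proof -
  have self: "v \<in> orbit f v" if "v \<in> A" for v
    using bij_betw_self_in_orbit[OF assms(1,2) that] .
  have inv: "\<forall>v \<in> A. orbit f v = orbit f a"
  proof (rule const)
    fix v assume "v \<in> A"
    then have "f v \<in> orbit f v" "v \<in> orbit f (f v)"
      using self orbit_swap[of v f "f v"] by (auto intro: orbit.base)
    then show "orbit f (f v) = orbit f v" by (auto intro: orbit_trans)
  qed
  have "v \<in> A" if "v \<in> orbit f a" for v
    using that by induct (use assms in \<open>auto simp: bij_betw_def\<close>)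
  moreover have "v \<in> orbit f a" if "v \<in> A" for v
    using inv self that by blast
  ultimately have "A = orbit f a" by blast
  then show ?thesis using assms(3) by (auto simp: cyclic_on_def)
qed

lemma cas_awalk_verts_trajectory:
  fixes G :: "('a, 'a \<times> 'a) pre_digraph" and g :: "nat \<Rightarrow> 'a"
  assumes "tail G = fst" "head G = snd"
  shows "pre_digraph.cas G (g a) (map (\<lambda>k. (g k, g (Suc k))) [a..<a + n]) (g (a + n)) \<and>
    pre_digraph.awalk_verts G (g a) (map (\<lambda>k. (g k, g (Suc k))) [a..<a + n]) = map g [a..<Suc (a + n)]"
proof (induct n arbitrary: a)
  case (Suc n)
  have "[a..<a + Suc n] = a # [Suc a..<Suc a + n]" "[a..<Suc (a + Suc n)] = a # [Suc a..<Suc (Suc a + n)]"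
    by (simp_all add: upt_conv_Cons del: upt_Suc)
  then show ?case
    using Suc[of "Suc a"] assms
    by (simp add: pre_digraph.cas.simps pre_digraph.awalk_verts.simps del: upt_Suc)
qed (simp add: pre_digraph.cas.simps pre_digraph.awalk_verts.simps)

lemma directed_hamilton_cycle_if_cyclic_on:
  fixes G :: "('a, 'a \<times> 'a) pre_digraph"
  assumes "tail G = fst" "head G = snd"
    and "finite (verts G)" "cyclic_on f (verts G)" "inj_on f (verts G)"
    and arcs: "(\<lambda>v. (v, f v)) ` verts G \<subseteq> arcs G"
  shows "\<exists>p. directed_hamilton_cycle G p \<and> set p = (\<lambda>v. (v, f v)) ` verts G"
proof -
  obtain s where s: "s \<in> verts G" "verts G = orbit f s"
    using assms(4) by (auto simp: cyclic_on_def)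
  \<comment> \<open>The first return time of \<open>s\<close>, hence the length of the
    cycle.\<close>
  define N where "N = funpow_dist1 f s s"
  define g where "g = (\<lambda>n. (f ^^ n) s)"
  have verts: "verts G = g ` {0..<N}"
    using s orbit_conv_funpow_dist1[of s f] by (simp add: N_def g_def)
  have inj: "inj_on g {0..<N}"
    using s inj_on_funpow_dist1[of s f s] by (simp add: N_def g_def)
  have wrap: "g N = s" using s funpow_dist1_prop[of s f s] by (simp only: N_def g_def)
  have "0 < N" by (simp add: N_def)
  have g: "g 0 = s" "\<And>n. g (Suc n) = f (g n)" by (simp_all add: g_def)
  define p where "p = map (\<lambda>k. (g k, g (Suc k))) [0..<0 + N]"
  have set_p: "set p = (\<lambda>v. (v, f v)) ` verts G"
    by (simp add: p_def verts image_image g)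
  have walk: "pre_digraph.cas G s p s" "pre_digraph.awalk_verts G s p = map g [0..<Suc N]"
    using cas_awalk_verts_trajectory[OF assms(1,2), of g 0 N] wrap g(1)
    unfolding p_def by simp_all
  \<comment> \<open>A cycle must not repeat a vertex once the first is dropped. The remaining ones
    are the \<open>f\<close>-images of \<open>g 0\<close> to \<open>g (N - 1)\<close>, so
    injectivity of \<open>f\<close> carries distinctness over.\<close>
  then have "tl (pre_digraph.awalk_verts G s p) = map (f \<circ> g) [0..<N]"
    by (simp add: map_Suc_upt[symmetric] upt_conv_Cons g comp_def del: upt_Suc)
  moreover have "inj_on f (g ` {0..<N})"
    using assms(5) verts by simp
  then have "inj_on (f \<circ> g) {0..<N}" using inj by (rule comp_inj_on[rotated])
  ultimately have "distinct (tl (pre_digraph.awalk_verts G s p))"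
    by (simp add: distinct_map)
  moreover have "p \<noteq> []" using \<open>0 < N\<close> by (simp add: p_def)
  moreover have "fst ` set p = verts G" by (simp add: set_p image_image)
  moreover have "s \<in> verts G" using s by simp
  ultimately show ?thesis
    unfolding directed_hamilton_cycle_def pre_digraph.cycle_def pre_digraph.awalk_def
    using walk(1) set_p arcs assms(1) by metis
qed

section \<open>The direction assignment on the layers\<close>

lemma finite_V: "finite (V m)"
  by (simp add: V_def)

lemma card_V: "0 \<le> m \<Longrightarrow> int (card (V m)) = m ^ 3"
  by (simp add: V_def card_cartesian_product power3_eq_cube)

lemma route_E_cases:
  "route_E m v \<in> {[0, 1, 2], [0, 2, 1], [1, 0, 2], [1, 2, 0], [2, 0, 1], [2, 1, 0]}" (is "_ \<in> ?P")
proof -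
  have if_in: "(if b then x else y) \<in> ?P" if "x \<in> ?P" "y \<in> ?P" for b x y
    using that by (cases b) simp_all
  show ?thesis
    unfolding route_E_def layer0_X_def layer0_Y_def by (intro if_in) simp_all
qed

lemma route_E_permutation:
  "length (route_E m v) = 3 \<and> distinct (route_E m v) \<and> set (route_E m v) = {0, 1, 2}"
proof -
  have "length xs = 3 \<and> distinct xs \<and> set xs = {0, 1, 2}"
    if "xs \<in> {[0, 1, 2], [0, 2, 1], [1, 0, 2], [1, 2, 0], [2, 0, 1], [2, 1, 0]}" for xs :: "nat list"
    using that by (elim insertE emptyE) auto
  then show ?thesis using route_E_cases by blast
qed

lemma route_E_nth: "c < 3 \<Longrightarrow> route_E m v ! c \<in> {0, 1, 2}"
  using route_E_permutation[of m v] by (metis nth_mem)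

section \<open>Residues modulo \<open>m\<close> and single steps on the torus\<close>

lemma mod_Suc_if:
  fixes x m :: int
  assumes "0 \<le> x" "x < m"
  shows "(x + 1) mod m = (if x = m - 1 then 0 else x + 1)"
  using assms by auto

lemma dvd_iff_small:
  fixes x m :: int
  assumes "0 \<le> x" "x < m"
  shows "m dvd x \<longleftrightarrow> x = 0" "m dvd x + 1 \<longleftrightarrow> x = m - 1"
proof -
  show "m dvd x \<longleftrightarrow> x = 0" using assms zdvd_not_zless[of x m] by (auto simp: le_less)
  have "\<not> m dvd x + 1" if "x + 1 < m" using assms that zdvd_not_zless[of "x + 1" m] by auto
  then show "m dvd x + 1 \<longleftrightarrow> x = m - 1" using assms by (cases "x + 1 = m") auto
qed

lemma sum3_mod:
  fixes i j k m :: int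
  shows "(i mod m + j + k) mod m = (i + j + k) mod m"
    and "(i + j mod m + k) mod m = (i + j + k) mod m"
    and "(i + j + k mod m) mod m = (i + j + k) mod m"
  by (metis add.assoc mod_add_left_eq, metis mod_add_left_eq mod_add_right_eq, metis mod_add_right_eq)

lemma step_in_V: "0 < m \<Longrightarrow> v \<in> V m \<Longrightarrow> step m d v \<in> V m"
  by (auto simp: V_def step_def)

lemma S_step: "S m (step m d v) = (S m v + 1) mod m"
proof (cases v)
  case (fields i j k)
  then show ?thesis
    by (simp add: S_def step_def sum3_mod mod_add_left_eq) (simp add: ac_simps)
qed

lemma mod_Suc_inj:
  fixes x y m :: int
  assumes "0 \<le> x" "x < m" "0 \<le> y" "y < m" "(x + 1) mod m = (y + 1) mod m"
  shows "x = y"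
  using assms by (simp add: mod_Suc_if split: if_splits)

lemma inj_on_step: "inj_on (step m d) (V m)"
proof (rule inj_onI)
  fix v w assume vw: "v \<in> V m" "w \<in> V m" "step m d v = step m d w"
  obtain i j k i' j' k' where "v = (i, j, k)" "w = (i', j', k')" by (metis prod_cases3)
  with vw show "v = w"
    using mod_Suc_inj[of i m i'] mod_Suc_inj[of j m j'] mod_Suc_inj[of k m k']
    by (simp add: V_def step_def split: if_splits)
qed

lemma step_direction_inj:
  assumes "3 \<le> m" "v \<in> V m" "step m d v = step m d' v" "d \<in> {0, 1, 2}" "d' \<in> {0, 1, 2}"
  shows "d = d'"
proof (cases v)
  case (fields i j k)
  have neq: "(x + 1) mod m \<noteq> x" if "0 \<le> x" "x < m" for x
    using that assms(1) by (simp add: mod_Suc_if)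
  show ?thesis
    using assms(2-5) neq[of i] neq[of j] neq[of k] unfolding fields V_def step_def
    by (elim insertE emptyE) auto
qed

text \<open>The third coordinate on the layer \<open>S = 0\<close>. Its piecewise linear form turns
  membership in the special sets into linear conditions on \<open>i\<close> and
  \<open>j\<close>.\<close>

lemma minus_sum_mod:
  fixes i j m :: int
  assumes "0 \<le> i" "i < m" "0 \<le> j" "j < m"
  shows "(- i - j) mod m = (if i + j = 0 then 0 else if i + j \<le> m then m - i - j else 2 * m - i - j)"
proof -
  consider "i + j = 0" | "0 < i + j" "i + j \<le> m" | "m < i + j" using assms by linarith
  then show ?thesis
  proof cases
    case 1 then show ?thesis using assms by simp
  next
    case 2
    have "(- i - j) mod m = (m - i - j) mod m" by (simp add: mod_eq_dvd_iff)
    also have "\<dots> = m - i - j" using 2 by (intro mod_pos_pos_trivial) auto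
    finally show ?thesis using 2 by simp
  next
    case 3
    have "(- i - j) mod m = (2 * m - i - j) mod m" by (simp add: mod_eq_dvd_iff)
    also have "\<dots> = 2 * m - i - j" using 3 assms by (intro mod_pos_pos_trivial) auto
    finally show ?thesis using 3 assms by simp
  qed
qed

lemma layer0_X_plane:
  assumes "6 \<le> m" "0 \<le> i" "i < m" "0 \<le> j" "j < m"
  shows "layer0_X m (i, j, (- i - j) mod m) =
    (if i = 0 \<and> j = 0 \<or> 1 \<le> i \<and> i \<le> m - 3 \<and> j = 1 \<or> i = m - 1 \<and> j = 2 then [1, 0, 2]
     else if i = 0 \<and> j = 1 \<or> 1 \<le> i \<and> i \<le> m - 3 \<and> i + j = m \<or> i = m - 1 \<and> j = 0 then [0, 2, 1]
     else if i = 0 \<and> 2 \<le> j \<or> i = 1 \<and> j = 0 then [2, 1, 0]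
     else if i = m - 2 \<and> j = 1 then [0, 1, 2]
     else if i = m - 2 \<and> j = 2 then [2, 0, 1]
     else [1, 2, 0])"
proof -
  let ?k = "(- i - j) mod m"
  note k = minus_sum_mod[OF assms(2-5)]
  have "(i, j, ?k) \<in> X102 m \<longleftrightarrow> i = 0 \<and> j = 0 \<or> 1 \<le> i \<and> i \<le> m - 3 \<and> j = 1 \<or> i = m - 1 \<and> j = 2"
    using assms unfolding k X102_def by auto
  moreover have "(i, j, ?k) \<in> X021 m \<longleftrightarrow>
      i = 0 \<and> j = 1 \<or> 1 \<le> i \<and> i \<le> m - 3 \<and> i + j = m \<or> i = m - 1 \<and> j = 0"
    using assms unfolding k X021_def by auto
  moreover have "(i, j, ?k) \<in> X210 m \<longleftrightarrow> i = 0 \<and> 2 \<le> j \<or> i = 1 \<and> j = 0"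
    using assms unfolding k X210_def by auto
  moreover have "(i, j, ?k) = (m - 2, 1, 1) \<longleftrightarrow> i = m - 2 \<and> j = 1"
    "(i, j, ?k) = (m - 2, 2, 0) \<longleftrightarrow> i = m - 2 \<and> j = 2"
    using assms unfolding k by auto
  ultimately show ?thesis unfolding layer0_X_def by (simp only:)
qed

lemma layer0_Y_plane:
  assumes "6 \<le> m" "0 \<le> i" "i < m" "0 \<le> j" "j < m"
  shows "layer0_Y m (i, j, (- i - j) mod m) =
    (if i = 0 \<and> j = 0 \<or> 2 \<le> i \<and> i \<le> m - 3 \<and> j = 1 \<or> i = m - 1 \<and> j = 2 then [1, 0, 2]
     else if i = 0 \<and> j = 1 \<or> 2 \<le> i \<and> i \<le> m - 3 \<and> i + j = m \<or> i = m - 1 \<and> j = 0 then [0, 2, 1]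
     else if i = 0 \<and> 2 \<le> j \<or> i = 1 \<and> j \<noteq> 1 \<and> j \<noteq> m - 1
        \<or> i = 2 \<and> (j = 0 \<or> j = m - 1) then [2, 1, 0]
     else if (i = 1 \<or> i = m - 2) \<and> j = 1 then [0, 1, 2]
     else if i = 1 \<and> j = m - 1 \<or> i = m - 2 \<and> j = 2 then [2, 0, 1]
     else [1, 2, 0])"
proof -
  let ?k = "(- i - j) mod m"
  note k = minus_sum_mod[OF assms(2-5)]
  have "(i, j, ?k) \<in> Y102 m \<longleftrightarrow> i = 0 \<and> j = 0 \<or> 2 \<le> i \<and> i \<le> m - 3 \<and> j = 1 \<or> i = m - 1 \<and> j = 2"
    using assms unfolding k Y102_def by auto
  moreover have "(i, j, ?k) \<in> Y021 m \<longleftrightarrow>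
      i = 0 \<and> j = 1 \<or> 2 \<le> i \<and> i \<le> m - 3 \<and> i + j = m \<or> i = m - 1 \<and> j = 0"
    using assms unfolding k Y021_def by auto
  moreover have "(i, j, ?k) \<in> Y210 m \<longleftrightarrow> i = 0 \<and> 2 \<le> j \<or> i = 1 \<and> j \<noteq> 1 \<and> j \<noteq> m - 1
      \<or> i = 2 \<and> (j = 0 \<or> j = m - 1)"
    using assms unfolding k Y210_def by auto
  moreover have "(i, j, ?k) \<in> {(1, 1, m - 2), (m - 2, 1, 1)} \<longleftrightarrow> (i = 1 \<or> i = m - 2) \<and> j = 1"
    "(i, j, ?k) \<in> {(1, m - 1, 0), (m - 2, 2, 0)} \<longleftrightarrow> i = 1 \<and> j = m - 1 \<or> i = m - 2 \<and> j = 2"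
    using assms unfolding k by auto
  ultimately show ?thesis unfolding layer0_Y_def by (simp only:)
qed

lemma route_E_plane:
  "route_E m (i, j, (- i - j) mod m) =
    (if m mod 6 \<in> {0, 2} then layer0_X m (i, j, (- i - j) mod m) else layer0_Y m (i, j, (- i - j) mod m))"
  using sum3_mod(3)[of i j "- i - j" m] by (simp add: route_E_def S_def)

text \<open>\<open>h\<close>, \<open>h1\<close> and \<open>h2\<close> below are the restrictions of \<open>H\<close> to the layers \<open>S = 0, 1, 2\<close>, in the
  coordinates \<open>(i, j)\<close>; on the remaining layers \<open>f\<^sub>c\<close> just adds direction \<open>c\<close>.\<close>

locale orbit_invariant =
  fixes m :: int and c :: nat and H :: "point \<Rightarrow> 'b"
  assumes m_ge: "6 \<le> m" and m_even: "even m" and c_le: "c < 3"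
    and invariant: "\<And>v. v \<in> V m \<Longrightarrow> H (route_E_map m c v) = H v"
begin

text \<open>The periodic extension to integer triples, on which a step is plain addition.\<close>

definition H' :: "int \<Rightarrow> int \<Rightarrow> int \<Rightarrow> 'b" where
  "H' i j k = H (i mod m, j mod m, k mod m)"

lemma H'_cong:
  assumes "i mod m = i' mod m" "j mod m = j' mod m" "k mod m = k' mod m"
  shows "H' i j k = H' i' j' k'"
  using assms by (simp add: H'_def)

lemma H'_step:
  assumes "route_E m (i mod m, j mod m, k mod m) ! c = d"
  shows "H' i j k = (if d = 0 then H' (i + 1) j k else if d = 1 then H' i (j + 1) k else H' i j (k + 1))"
proof -
  have "(i mod m, j mod m, k mod m) \<in> V m" using m_ge by (simp add: V_def)
  from invariant[OF this] show ?thesis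
    unfolding H'_def route_E_map_def assms step_def by (auto simp: mod_simps)
qed

lemma route_E_mod:
  assumes "i + j + k = s"
  shows "s mod m = 1 \<Longrightarrow> route_E m (i mod m, j mod m, k mod m) = (if m dvd i then [1, 0, 2] else [2, 0, 1])"
    and "s mod m = 2 \<Longrightarrow> route_E m (i mod m, j mod m, k mod m) = (if m dvd j then [2, 1, 0] else [0, 1, 2])"
    and "2 < s mod m \<Longrightarrow> route_E m (i mod m, j mod m, k mod m) = [0, 1, 2]"
proof -
  have "S m (i mod m, j mod m, k mod m) = s mod m" using assms by (simp add: S_def sum3_mod)
  then show "s mod m = 1 \<Longrightarrow> route_E m (i mod m, j mod m, k mod m) = (if m dvd i then [1, 0, 2] else [2, 0, 1])"
    "s mod m = 2 \<Longrightarrow> route_E m (i mod m, j mod m, k mod m) = (if m dvd j then [2, 1, 0] else [0, 1, 2])"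
    "2 < s mod m \<Longrightarrow> route_E m (i mod m, j mod m, k mod m) = [0, 1, 2]"
    by (auto simp: route_E_def dvd_eq_mod_eq_0)
qed

definition h :: "int \<Rightarrow> int \<Rightarrow> 'b" where
  "h i j = H' i j (- i - j)"

definition h1 :: "int \<Rightarrow> int \<Rightarrow> 'b" where
  "h1 i j = H' i j (1 - i - j)"

definition h2 :: "int \<Rightarrow> int \<Rightarrow> 'b" where
  "h2 i j = H' i j (2 - i - j)"

sublocale torus_invariant m h
proof
  show "h (i + m) j = h i j" for i j
    unfolding h_def by (intro H'_cong) (auto simp: mod_simps mod_eq_dvd_iff)
  show "h i (j + m) = h i j" for i j
    unfolding h_def by (intro H'_cong) (auto simp: mod_simps mod_eq_dvd_iff)
qed (fact m_ge m_even)+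

lemma H'_tail:
  assumes "0 \<le> n" "n \<le> m - 3" "i + j + k = 3"
  shows "H' i j k = (if c = 0 then H' (i + n) j k else if c = 1 then H' i (j + n) k else H' i j (k + n))"
  using assms(1,2)
proof (induct n rule: int_ge_induct)
  case (step n)
  have "(3 + n) mod m = 3 + n" using step by (intro mod_pos_pos_trivial) auto
  then have s: "2 < (3 + n) mod m" using step by simp
  consider "c = 0" | "c = 1" | "c = 2" using c_le by linarith
  then show ?case
  proof cases
    case 1
    then have "H' (i + n) j k = H' (i + n + 1) j k"
      using route_E_mod(3)[of "i + n" j k "3 + n"] s assms(3) by (subst H'_step) auto
    then show ?thesis using step 1 by (simp add: add.assoc)
  next
    case 2
    then have "H' i (j + n) k = H' i (j + n + 1) k"
      using route_E_mod(3)[of i "j + n" k "3 + n"] s assms(3) by (subst H'_step) auto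
    then show ?thesis using step 2 by (simp add: add.assoc)
  next
    case 3
    then have "H' i j (k + n) = H' i j (k + n + 1)"
      using route_E_mod(3)[of i j "k + n" "3 + n"] s assms(3) by (subst H'_step) auto
    then show ?thesis using step 3 by (simp add: add.assoc)
  qed
qed simp

text \<open>The \<open>m - 3\<close> steps back to the layer \<open>S = 0\<close> add
  \<open>- 3\<close> modulo \<open>m\<close> to coordinate \<open>c\<close>; for colour 2 this is
  the third coordinate, invisible in \<open>(i, j)\<close>.\<close>

lemma layer3: "H' i j (3 - i - j) = (if c = 0 then h (i - 3) j else if c = 1 then h i (j - 3) else h i j)"
proof -
  have "H' (i + (m - 3)) j (3 - i - j) = H' (i - 3) j (- (i - 3) - j)"
    "H' i (j + (m - 3)) (3 - i - j) = H' i (j - 3) (- i - (j - 3))"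
    "H' i j (3 - i - j + (m - 3)) = H' i j (- i - j)"
    by (intro H'_cong; auto simp: mod_eq_dvd_iff)+
  then show ?thesis using H'_tail[of "m - 3" i j "3 - i - j"] m_ge by (simp add: h_def)
qed

lemma layer2: "h2 i j =
  (if c = 0 then if m dvd j then h (i - 3) j else h (i - 2) j
   else if c = 1 then h i (j - 2)
   else if m dvd j then h (i + 1) j else h i j)"
proof -
  have s: "i + j + (2 - i - j) = 2" "2 mod m = 2" using m_ge by auto
  have 3: "H' (i + 1) j (2 - i - j) = H' (i + 1) j (3 - (i + 1) - j)"
    "H' i (j + 1) (2 - i - j) = H' i (j + 1) (3 - i - (j + 1))"
    "H' i j (2 - i - j + 1) = H' i j (3 - i - j)"
    by (simp_all add: algebra_simps)
  have "c = 0 \<or> c = 1 \<or> c = 2" using c_le by linarith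
  then show ?thesis
    using H'_step[OF refl, of i j "2 - i - j", unfolded route_E_mod(2)[OF s] 3 layer3]
    by (elim disjE) (simp_all add: h2_def split: if_splits)
qed

lemma layer1: "h1 i j =
  (if c = 0 then if m dvd i then h2 i (j + 1) else h2 i j
   else if c = 1 then h2 (i + 1) j
   else if m dvd i then h2 i j else h2 i (j + 1))"
proof -
  have s: "i + j + (1 - i - j) = 1" "1 mod m = 1" using m_ge by auto
  have 2: "H' (i + 1) j (1 - i - j) = h2 (i + 1) j"
    "H' i (j + 1) (1 - i - j) = h2 i (j + 1)" "H' i j (1 - i - j + 1) = h2 i j"
    by (simp_all add: h2_def algebra_simps)
  have "c = 0 \<or> c = 1 \<or> c = 2" using c_le by linarith
  then show ?thesis
    using H'_step[OF refl, of i j "1 - i - j", unfolded route_E_mod(1)[OF s] 2]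
    by (elim disjE) (simp_all add: h1_def split: if_splits)
qed

lemma layer0:
  assumes "0 \<le> i" "i < m" "0 \<le> j" "j < m"
    and "route_E m (i, j, (- i - j) mod m) ! c = d"
  shows "h i j = (if d = 0 then h1 (i + 1) j else if d = 1 then h1 i (j + 1) else h1 i j)"
proof -
  have "H' (i + 1) j (- i - j) = h1 (i + 1) j"
    "H' i (j + 1) (- i - j) = h1 i (j + 1)" "H' i j (- i - j + 1) = h1 i j"
    by (simp_all add: h1_def algebra_simps)
  then show ?thesis
    unfolding h_def using assms by (subst H'_step[where d = d]) auto
qed

end

section \<open>The \<open>m\<close>-th iterate of each colour map on the layer
  \<open>S = 0\<close>\<close>

context orbit_invariant
begin

lemma dvd_add_2: "0 \<le> x \<Longrightarrow> x < m \<Longrightarrow> m dvd x + 2 \<longleftrightarrow> x = m - 2"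
  using m_ge dvd_iff_small[of "x + 2" m] dvd_iff_small[of 1 m]
  by (cases "x = m - 2"; cases "x = m - 1") auto

lemma shifts:
  fixes x :: int
  shows "x + 1 + 1 = x + 2" "x + 1 - 2 = x - 1" "x + 1 - 3 = x - 2"
  by simp_all

text \<open>Composes the steps through the layers 0, 1 and 2 with the uniform remainder. Tests such
  as \<open>i = m - 1\<close> or \<open>j = m - 2\<close> are the zero tests of layers 1 and 2, read
  before the coordinate has moved.\<close>

lemma plane_step0:
  assumes "0 \<le> i" "i < m" "0 \<le> j" "j < m" "c = 0"
    and "route_E m (i, j, (- i - j) mod m) ! 0 = d"
  shows "h i j =
    (if d = 0 then if i = m - 1 then if j = m - 1 then h (i - 2) (j + 1) else h (i - 1) (j + 1)
                   else if j = 0 then h (i - 2) j else h (i - 1) j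
     else if d = 1 then if i = 0 then if j = m - 2 then h (i - 3) (j + 2) else h (i - 2) (j + 2)
                        else if j = m - 1 then h (i - 3) (j + 1) else h (i - 2) (j + 1)
     else if i = 0 then if j = m - 1 then h (i - 3) (j + 1) else h (i - 2) (j + 1)
          else if j = 0 then h (i - 3) j else h (i - 2) j)"
proof -
  note dvd = dvd_iff_small[OF assms(1,2)] dvd_iff_small[OF assms(3,4)] dvd_add_2[OF assms(3,4)]
  show ?thesis
    using layer0[OF assms(1-4), of d] assms(6)
    unfolding layer1 layer2 shifts dvd assms(5) by (simp cong: if_cong)
qed

text \<open>Colour 1 has the same direction in both rules of layer 1 and in both rules of layer 2,
  so only the choice on the layer \<open>S = 0\<close> remains.\<close>

lemma plane_step1:
  assumes "0 \<le> i" "i < m" "0 \<le> j" "j < m" "c = 1"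
    and "route_E m (i, j, (- i - j) mod m) ! 1 = (if P then 0 else if Q then 1 else 2)"
  shows "h i j = (if P then h (i + 2) (j - 2) else if Q then h (i + 1) (j - 1) else h (i + 1) (j - 2))"
  using layer0[OF assms(1-4) refl] unfolding layer1 layer2 shifts assms(5,6)
  by (cases P; cases Q) simp_all

lemma plane_step2:
  assumes "0 \<le> i" "i < m" "0 \<le> j" "j < m" "c = 2"
    and "route_E m (i, j, (- i - j) mod m) ! 2 = d"
  shows "h i j =
    (if d = 0 then if i = m - 1 then if j = 0 then h (i + 2) j else h (i + 1) j
                   else if j = m - 1 then h (i + 2) (j + 1) else h (i + 1) (j + 1)
     else if d = 1 then if i = 0 then if j = m - 1 then h (i + 1) (j + 1) else h i (j + 1)
                        else if j = m - 2 then h (i + 1) (j + 2) else h i (j + 2)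
     else if i = 0 then if j = 0 then h (i + 1) j else h i j
          else if j = m - 1 then h (i + 1) (j + 1) else h i (j + 1))"
proof -
  note dvd = dvd_iff_small[OF assms(1,2)] dvd_iff_small[OF assms(3,4)] dvd_add_2[OF assms(3,4)]
  show ?thesis
    using layer0[OF assms(1-4), of d] assms(6)
    unfolding layer1 layer2 shifts dvd assms(5) by (simp cong: if_cong)
qed

lemma period: "h m j = h 0 j" "h i m = h i 0"
  using period_i[of 0 j] period_j[of i 0] by simp_all

lemma color0X: "c = 0 \<Longrightarrow> m mod 6 \<in> {0, 2} \<Longrightarrow> color0X_invariant m h"
proof unfold_locales
  fix i j assume c: "c = 0" and m: "m mod 6 \<in> {0, 2}" and ij: "0 \<le> i" "i < m" "0 \<le> j" "j < m"
  show "h i j =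
    (if i = 0 \<and> j = 0 then h (i - 2) (j + 2)
     else if i = m - 1 \<and> j = 0 then h (i - 1) (j + 1)
     else if i = 1 \<and> j = 0 then h (i - 3) j
     else if i = m - 2 \<and> j = 2 then h (i - 2) j
     else if (i = 0 \<or> i = m - 2) \<and> j = 1 \<or> i + j = m \<and> 3 \<le> j then h (i - 1) j
     else if j = m - 1 then h (i - 3) (j + 1)
     else h (i - 2) (j + 1))"
    using m_ge ij
    unfolding plane_step0[OF ij c refl] route_E_plane if_P[OF m] layer0_X_plane[OF m_ge ij] 
    by auto
qed

lemma color0Y: "c = 0 \<Longrightarrow> m mod 6 = 4 \<Longrightarrow> color0Y_invariant m h"
proof unfold_locales
  fix i j assume c: "c = 0" and m: "m mod 6 = 4" and ij: "0 \<le> i" "i < m" "0 \<le> j" "j < m"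
  have m': "m mod 6 \<notin> {0, 2}" using m by simp
  show "h i j =
    (if i = 0 \<and> j = 0 then h (i - 2) (j + 2)
     else if i = m - 1 \<and> j = 0 then h (i - 1) (j + 1)
     else if (i = 1 \<or> i = 2) \<and> j = 0 then h (i - 3) j
     else if i = m - 2 \<and> j = 2 \<or> i = 1 \<and> 2 \<le> j \<or> i = 2 \<and> j = m - 1 then h (i - 2) j
     else if (i = 0 \<or> i = 1 \<or> i = m - 2) \<and> j = 1 \<or> i + j = m \<and> 3 \<le> j then h (i - 1) j
     else if j = m - 1 then h (i - 3) (j + 1)
     else h (i - 2) (j + 1))"
    using m_ge ij
    unfolding plane_step0[OF ij c refl] route_E_plane if_not_P[OF m'] layer0_Y_plane[OF m_ge ij] 
    by auto
qed

lemma color1X: "c = 1 \<Longrightarrow> m mod 6 \<in> {0, 2} \<Longrightarrow> color1X_invariant m h"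
proof unfold_locales
  show "m mod 6 = 0 \<or> m mod 6 = 2" if "m mod 6 \<in> {0, 2}"
    using that by simp
  fix i j assume c: "c = 1" and m: "m mod 6 \<in> {0, 2}" and ij: "0 \<le> i" "i < m" "0 \<le> j" "j < m"
  have "route_E m (i, j, (- i - j) mod m) ! 1 = (if i = 0 \<and> j = 0 \<or> 1 \<le> i \<and> i \<le> m - 3 \<and> j = 1 \<or> m - 2 \<le> i \<and> j = 2 then 0
     else if i = 0 \<and> 2 \<le> j \<or> i = 1 \<and> j = 0 \<or> i = m - 2 \<and> j = 1 then 1 else 2)"
    using m_ge ij unfolding route_E_plane if_P[OF m] layer0_X_plane[OF m_ge ij]
      if_distrib[of "\<lambda>xs. xs ! 1"] by auto
  note rule = plane_step1[OF ij c this]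
  show "h i j =
    (if i = 0 \<and> j = 0 \<or> 1 \<le> i \<and> i \<le> m - 3 \<and> j = 1 \<or> m - 2 \<le> i \<and> j = 2 then h (i + 2) (j - 2)
     else if i = 0 \<and> 2 \<le> j \<or> i = 1 \<and> j = 0 \<or> i = m - 2 \<and> j = 1 then h (i + 1) (j - 1)
     else h (i + 1) (j - 2))"
    by (rule rule)
qed

lemma color1Y: "c = 1 \<Longrightarrow> m mod 6 = 4 \<Longrightarrow> color1Y_invariant m h"
proof unfold_locales
  fix i j assume c: "c = 1" and m: "m mod 6 = 4" and ij: "0 \<le> i" "i < m" "0 \<le> j" "j < m"
  have m': "m mod 6 \<notin> {0, 2}" using m by simp
  have "route_E m (i, j, (- i - j) mod m) ! 1 = (if i = 0 \<and> j = 0 \<or> 2 \<le> i \<and> i \<le> m - 3 \<and> j = 1 \<or> m - 2 \<le> i \<and> j = 2 \<or> i = 1 \<and> j = m - 1 then 0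
     else if i = 0 \<and> 2 \<le> j \<or> i = 1 \<or> i = 2 \<and> (j = 0 \<or> j = m - 1) \<or> i = m - 2 \<and> j = 1 then 1 else 2)"
    using m_ge ij unfolding route_E_plane if_not_P[OF m'] layer0_Y_plane[OF m_ge ij]
      if_distrib[of "\<lambda>xs. xs ! 1"] by auto
  note rule = plane_step1[OF ij c this]
  show "h i j =
    (if i = 0 \<and> j = 0 \<or> 2 \<le> i \<and> i \<le> m - 3 \<and> j = 1 \<or> m - 2 \<le> i \<and> j = 2 \<or> i = 1 \<and> j = m - 1
     then h (i + 2) (j - 2)
     else if i = 0 \<and> 2 \<le> j \<or> i = 1 \<or> i = 2 \<and> (j = 0 \<or> j = m - 1) \<or> i = m - 2 \<and> j = 1
     then h (i + 1) (j - 1)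
     else h (i + 1) (j - 2))"
    by (rule rule)
qed

lemma color2: "c = 2 \<Longrightarrow> color2_invariant m h"
proof unfold_locales
  fix i j assume c: "c = 2" and ij: "0 \<le> i" "i < m" "0 \<le> j" "j < m"
  \<comment> \<open>Both assignments give colour 2 the same directions, so \<open>m mod 6\<close>
    does not matter here.\<close>
  let ?d = "if i = 0 \<and> j = 0 \<or> 1 \<le> i \<and> i \<le> m - 2 \<and> j = 1 \<or> i = m - 1 \<and> j = 2 then 2
     else if i = 0 \<and> j = 1 \<or> 1 \<le> i \<and> i \<le> m - 2 \<and> i + j = m \<or> i = m - 1 \<and> j = 0 then 1
     else 0 :: nat"
  have column: "i = 0 \<or> i = 1 \<or> i = 2 \<or> i = m - 2 \<or> i = m - 1 \<or> 3 \<le> i \<and> i \<le> m - 3"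
    using ij by linarith
  have "layer0_X m (i, j, (- i - j) mod m) ! 2 = ?d"
    using m_ge ij unfolding layer0_X_plane[OF m_ge ij] if_distrib[of "\<lambda>xs. xs ! 2"] by auto
  moreover have "layer0_Y m (i, j, (- i - j) mod m) ! 2 = ?d"
    using column m_ge ij unfolding layer0_Y_plane[OF m_ge ij] if_distrib[of "\<lambda>xs. xs ! 2"]
    by (elim disjE conjE) simp_all
  ultimately have "route_E m (i, j, (- i - j) mod m) ! 2 = ?d"
    unfolding route_E_plane by (cases "m mod 6 \<in> {0, 2}") (simp_all only: if_True if_False)
  note rule = plane_step2[OF ij c this]
  show "h i j =
    (if j = 0 then if i = 0 then h 1 0 else if i = m - 1 then h i 2 else h (i + 1) 1
     else if i = m - 1 then if j = 2 then h i 3 else h 0 j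
     else if j = 1 then h i 2
     else if i + j = m then if j = m - 2 then h (i + 1) 0 else h i (j + 2)
     else if j = m - 1 then h (i + 2) 0
     else h (i + 1) (j + 1))"
    using column
  proof (elim disjE conjE)
    assume "i = 0" then show ?thesis using m_ge ij period(2)[of 2] by (subst rule) auto
  next
    assume "i = 1" then show ?thesis using m_ge ij period(2)[of 3] by (subst rule) auto
  next
    assume "i = 2" then show ?thesis using m_ge ij period(2)[of 3] period(2)[of 4]
      by (subst rule) (auto simp: add.commute)
  next
    assume "i = m - 2" then show ?thesis using m_ge ij period(2)[of m] period(1)[of 0] by (subst rule) auto
  next
    assume "i = m - 1" then show ?thesis using m_ge ij period(1)[of j] by (subst rule) auto
  next
    assume "3 \<le> i" "i \<le> m - 3"
    then show ?thesis using m_ge ij period(2)[of "i + 2"] by (subst rule) auto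
  qed
qed

end

section \<open>Bijectivity and the theorem\<close>

text \<open>Injectivity on the layer \<open>S = 0\<close>: no vertex is entered along two different directions. The
  three cases of each \<open>no_clash\<close> lemma are the three pairs of directions.\<close>

definition succ_mod :: "int \<Rightarrow> int \<Rightarrow> int" where
  "succ_mod m x = (if x = m - 1 then 0 else x + 1)"

lemma column_cases:
  fixes i m :: int
  assumes "0 \<le> i" "i < m"
  shows "i = 0 \<or> i = 1 \<or> i = 2 \<or> i = m - 3 \<or> i = m - 2 \<or> i = m - 1 \<or> 3 \<le> i \<and> i < m - 3"
  using assms by linarith

lemma layer0_X_no_clash:
  assumes "6 \<le> m" "0 \<le> i" "i < m" "0 \<le> j" "j < m" "c \<in> {0, 1, 2}"
  defines "d \<equiv> \<lambda>i j. layer0_X m (i, j, (- i - j) mod m) ! c"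
  shows "d i (succ_mod m j) = 0 \<Longrightarrow> d (succ_mod m i) j \<noteq> 1"
    and "d i j = 0 \<Longrightarrow> d (succ_mod m i) j \<noteq> 2"
    and "d i j = 1 \<Longrightarrow> d i (succ_mod m j) \<noteq> 2"
proof -
  have s: "0 \<le> succ_mod m i" "succ_mod m i < m" "0 \<le> succ_mod m j" "succ_mod m j < m"
    using assms by (auto simp: succ_mod_def)
  note d = layer0_X_plane[OF assms(1) assms(2,3) assms(4,5)] layer0_X_plane[OF assms(1) s(1,2) assms(4,5)]
    layer0_X_plane[OF assms(1) assms(2,3) s(3,4)]
  show "d i (succ_mod m j) = 0 \<Longrightarrow> d (succ_mod m i) j \<noteq> 1"
    using column_cases[OF assms(2,3)] assms(1,4-6) unfolding d_def d
    by (elim disjE conjE insertE emptyE) (auto simp: succ_mod_def split: if_splits)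
  show "d i j = 0 \<Longrightarrow> d (succ_mod m i) j \<noteq> 2"
    using column_cases[OF assms(2,3)] assms(1,4-6) unfolding d_def d
    by (elim disjE conjE insertE emptyE) (auto simp: succ_mod_def split: if_splits)
  show "d i j = 1 \<Longrightarrow> d i (succ_mod m j) \<noteq> 2"
    using column_cases[OF assms(2,3)] assms(1,4-6) unfolding d_def d
    by (elim disjE conjE insertE emptyE) (auto simp: succ_mod_def split: if_splits)
qed

lemma layer0_Y_no_clash:
  assumes "6 \<le> m" "0 \<le> i" "i < m" "0 \<le> j" "j < m" "c \<in> {0, 1, 2}"
  defines "d \<equiv> \<lambda>i j. layer0_Y m (i, j, (- i - j) mod m) ! c"
  shows "d i (succ_mod m j) = 0 \<Longrightarrow> d (succ_mod m i) j \<noteq> 1"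
    and "d i j = 0 \<Longrightarrow> d (succ_mod m i) j \<noteq> 2"
    and "d i j = 1 \<Longrightarrow> d i (succ_mod m j) \<noteq> 2"
proof -
  have s: "0 \<le> succ_mod m i" "succ_mod m i < m" "0 \<le> succ_mod m j" "succ_mod m j < m"
    using assms by (auto simp: succ_mod_def)
  note d = layer0_Y_plane[OF assms(1) assms(2,3) assms(4,5)] layer0_Y_plane[OF assms(1) s(1,2) assms(4,5)]
    layer0_Y_plane[OF assms(1) assms(2,3) s(3,4)]
  show "d i (succ_mod m j) = 0 \<Longrightarrow> d (succ_mod m i) j \<noteq> 1"
    using column_cases[OF assms(2,3)] assms(1,4-6) unfolding d_def d
    by (elim disjE conjE insertE emptyE) (auto simp: succ_mod_def split: if_splits)
  show "d i j = 0 \<Longrightarrow> d (succ_mod m i) j \<noteq> 2"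
    using column_cases[OF assms(2,3)] assms(1,4-6) unfolding d_def d
    by (elim disjE conjE insertE emptyE) (auto simp: succ_mod_def split: if_splits)
  show "d i j = 1 \<Longrightarrow> d i (succ_mod m j) \<noteq> 2"
    using column_cases[OF assms(2,3)] assms(1,4-6) unfolding d_def d
    by (elim disjE conjE insertE emptyE) (auto simp: succ_mod_def split: if_splits)
qed

lemma S_bounds: "0 < m \<Longrightarrow> 0 \<le> S m v \<and> S m v < m"
  by (simp add: S_def split: prod.splits)

lemma S_eq_0_iff:
  assumes "(i, j, k) \<in> V m"
  shows "S m (i, j, k) = 0 \<longleftrightarrow> k = (- i - j) mod m"
proof -
  have "k = k mod m" using assms by (simp add: V_def)
  then have "k = (- i - j) mod m \<longleftrightarrow> k mod m = (- i - j) mod m" by simp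
  also have "\<dots> \<longleftrightarrow> m dvd i + j + k" by (simp add: mod_eq_dvd_iff algebra_simps)
  finally show ?thesis by (simp add: S_def dvd_eq_mod_eq_0)
qed

lemma route_E_no_clash:
  assumes "6 \<le> m" "0 \<le> i" "i < m" "0 \<le> j" "j < m" "c \<in> {0, 1, 2}"
  defines "d \<equiv> \<lambda>i j. route_E m (i, j, (- i - j) mod m) ! c"
  shows "d i (succ_mod m j) = 0 \<Longrightarrow> d (succ_mod m i) j \<noteq> 1"
    and "d i j = 0 \<Longrightarrow> d (succ_mod m i) j \<noteq> 2"
    and "d i j = 1 \<Longrightarrow> d i (succ_mod m j) \<noteq> 2"
  using layer0_X_no_clash[OF assms(1-6)] layer0_Y_no_clash[OF assms(1-6)]
  unfolding d_def route_E_plane by (auto split: if_splits)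

text \<open>The inequality is enough for equality, since the two vertices can be exchanged; this
  halves the pairs of directions to be compared.\<close>

lemma layer0_directions_le:
  assumes "6 \<le> m" "c \<in> {0, 1, 2}" and V: "(i, j, k) \<in> V m" "(i', j', k') \<in> V m"
    and S: "S m (i, j, k) = 0" "S m (i', j', k') = 0"
    and step: "step m (route_E m (i, j, k) ! c) (i, j, k) = step m (route_E m (i', j', k') ! c) (i', j', k')"
  shows "route_E m (i, j, k) ! c \<le> route_E m (i', j', k') ! c"
proof (rule ccontr)
  assume gt: "\<not> ?thesis"
  have ij: "0 \<le> i" "i < m" "0 \<le> j" "j < m" and ij': "0 \<le> i'" "i' < m" "0 \<le> j'" "j' < m"
    using V by (auto simp: V_def)
  have k: "k = (- i - j) mod m" "k' = (- i' - j') mod m" using S V S_eq_0_iff by blast+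
  define d d' where "d = route_E m (i, j, k) ! c" and "d' = route_E m (i', j', k') ! c"
  have "c < 3" using assms(2) by auto
  then have dd': "d \<in> {0, 1, 2}" "d' \<in> {0, 1, 2}" unfolding d_def d'_def by (intro route_E_nth; assumption)+
  have "d' < d" using gt by (simp add: d_def d'_def)
  have succ: "(x + 1) mod m = succ_mod m x" if "0 \<le> x" "x < m" for x
    using mod_Suc_if[OF that] by (simp add: succ_mod_def)
  have eq: "step m d (i, j, k) = step m d' (i', j', k')" using step by (simp add: d_def d'_def)
  \<comment> \<open>For directions 0 and 1 the base point of the clash is \<open>(i', j)\<close>,
    which mixes coordinates of the two vertices; hence the second instance.\<close>
  note no_clash = route_E_no_clash[OF assms(1) ij' assms(2)] route_E_no_clash[OF assms(1) ij'(1,2) ij(3,4) assms(2)]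
  consider "d' = 0" "d = 1" | "d' = 0" "d = 2" | "d' = 1" "d = 2"
    using dd' \<open>d' < d\<close> by auto
  then show False
  proof cases
    case 1
    then have "i = succ_mod m i'" "j' = succ_mod m j" using eq ij ij' by (auto simp: step_def succ)
    then show False using no_clash(4) 1 by (simp add: d_def d'_def k)
  next
    case 2
    then have "i = succ_mod m i'" "j = j'" using eq ij' by (auto simp: step_def succ)
    then show False using no_clash(2) 2 by (simp add: d_def d'_def k)
  next
    case 3
    then have "i = i'" "j = succ_mod m j'" using eq ij' by (auto simp: step_def succ)
    then show False using no_clash(3) 3 by (simp add: d_def d'_def k)
  qed
qed

lemma inj_on_route_E_map:
  assumes "6 \<le> m" "c \<in> {0, 1, 2}"
  shows "inj_on (route_E_map m c) (V m)"
proof (rule inj_onI)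
  fix v w assume vw: "v \<in> V m" "w \<in> V m" and eq: "route_E_map m c v = route_E_map m c w"
  obtain i j k i' j' k' where v: "v = (i, j, k)" and w: "w = (i', j', k')" by (metis prod_cases3)
  have "(S m v + 1) mod m = (S m w + 1) mod m"
    using eq S_step unfolding route_E_map_def by metis
  then have S: "S m v = S m w"
    using mod_Suc_inj[of "S m v" m "S m w"] S_bounds[of m] assms(1) by auto
  have "route_E m v ! c = route_E m w ! c"
  proof (cases "S m v = 0")
    case True
    then show ?thesis
      using layer0_directions_le[OF assms, of i j k i' j' k'] layer0_directions_le[OF assms, of i' j' k' i j k]
        vw S eq unfolding v w route_E_map_def by auto
  next
    case False
    then have v': "route_E m v = (if S m v = 1 then if i = 0 then [1, 0, 2] else [2, 0, 1]
        else if S m v = 2 then if j = 0 then [2, 1, 0] else [0, 1, 2] else [0, 1, 2])"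
      and w': "route_E m w = (if S m v = 1 then if i' = 0 then [1, 0, 2] else [2, 0, 1]
        else if S m v = 2 then if j' = 0 then [2, 1, 0] else [0, 1, 2] else [0, 1, 2])"
      using S unfolding route_E_def v w by simp_all
    \<comment> \<open>Where the direction in layer 1 or 2 depends on a coordinate being zero,
      neither possible direction changes that coordinate, so the image reveals which one was
      taken.\<close>
    show ?thesis
      using eq assms(2) unfolding route_E_map_def v' w' unfolding v w
      by (auto simp: step_def split: if_splits)
  qed
  then show "v = w"
    using inj_onD[OF inj_on_step] vw eq unfolding route_E_map_def by metis
qed

lemma bij_betw_route_E_map:
  assumes "6 \<le> m" "c \<in> {0, 1, 2}"
  shows "bij_betw (route_E_map m c) (V m) (V m)"
proof -
  have "route_E_map m c ` V m \<subseteq> V m"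
    unfolding route_E_map_def using assms(1) by (intro image_subsetI step_in_V) auto
  then show ?thesis
    using inj_on_route_E_map[OF assms] finite_V endo_inj_surj[of "V m" "route_E_map m c"]
    by (simp add: bij_betw_def)
qed

section \<open>From constancy on the layer \<open>S = 0\<close> to constancy on all of
  \<open>V m\<close>\<close>

context orbit_invariant
begin

lemma h_const:
  assumes "0 \<le> i" "i < m" "0 \<le> j" "j < m"
  shows "h i j = h 0 0"
proof -
  have m6: "m mod 6 \<in> {0, 2} \<or> m mod 6 = 4" using m_even by (simp, presburger)
  have "c = 0 \<or> c = 1 \<or> c = 2" using c_le by linarith
  then consider (zeroX) "c = 0" "m mod 6 \<in> {0, 2}" | (zeroY) "c = 0" "m mod 6 = 4"
    | (oneX) "c = 1" "m mod 6 \<in> {0, 2}" | (oneY) "c = 1" "m mod 6 = 4" | (two) "c = 2"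
    using m6 by blast
  then show ?thesis
  proof cases
    case zeroX
    then show ?thesis using color0X_invariant.const[OF color0X, of j i] assms by (meson less_imp_le)
  next
    case zeroY
    then show ?thesis using color0Y_invariant.const[OF color0Y, of j i] assms by (meson less_imp_le)
  next
    case oneX
    then show ?thesis using color1X_invariant.const[OF color1X, of i j] assms by (meson less_imp_le)
  next
    case oneY
    then show ?thesis using color1Y_invariant.const[OF color1Y, of i j] assms by (meson less_imp_le)
  next
    case two
    then show ?thesis using color2_invariant.const[OF color2 assms] by blast
  qed
qed

lemma reaches_layer0:
  assumes "v \<in> V m"
  shows "\<exists>w \<in> V m. S m w = 0 \<and> H v = H w"
  using assms
proof (induct "nat (m - S m v)" arbitrary: v rule: less_induct)
  case less
  have m: "0 < m" using m_ge by simp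
  show ?case
  proof (cases "S m v = 0")
    case False
    let ?w = "route_E_map m c v"
    have w: "?w \<in> V m" using less.prems m by (auto simp: route_E_map_def intro: step_in_V)
    have "S m ?w = (if S m v = m - 1 then 0 else S m v + 1)"
      using S_bounds[OF m, of v] by (simp add: route_E_map_def S_step mod_Suc_if)
    then have "S m ?w = 0 \<or> S m ?w = S m v + 1" by presburger
    then have "\<exists>u \<in> V m. S m u = 0 \<and> H ?w = H u"
    proof
      assume "S m ?w = S m v + 1"
      then show ?thesis using less.hyps[of ?w] w S_bounds[OF m, of v] by simp
    qed (use w in blast)
    then show ?thesis using invariant[OF less.prems] by simp
  qed (use less.prems in blast)
qed

lemma H_const:
  assumes "v \<in> V m"
  shows "H v = H (0, 0, 0)"
proof -
  obtain i j k where w: "(i, j, k) \<in> V m" "S m (i, j, k) = 0" "H v = H (i, j, k)"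
    using reaches_layer0[OF assms] by (metis prod_cases3)
  have ij: "0 \<le> i" "i < m" "0 \<le> j" "j < m" using w(1) by (auto simp: V_def)
  have "H (i, j, k) = h i j" using w S_eq_0_iff[OF w(1)] ij by (simp add: h_def H'_def)
  also have "\<dots> = h 0 0" using h_const ij by blast
  also have "\<dots> = H (0, 0, 0)" by (simp add: h_def H'_def)
  finally show ?thesis using w(3) by simp
qed

end

lemma cyclic_on_route_E_map:
  assumes "even m" "6 \<le> m" "c \<in> {0, 1, 2}"
  shows "cyclic_on (route_E_map m c) (V m)"
proof (rule cyclic_on_if_invariants_const[OF finite_V bij_betw_route_E_map[OF assms(2,3)]])
  show "(0, 0, 0) \<in> V m" using assms(2) by (simp add: V_def)
next
  fix H :: "point \<Rightarrow> point set"
  assume "\<And>v. v \<in> V m \<Longrightarrow> H (route_E_map m c v) = H v"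
  then interpret orbit_invariant m c H using assms by unfold_locales auto
  show "\<forall>v \<in> V m. H v = H (0, 0, 0)" using H_const by blast
qed

theorem theorem4p26:
  fixes m :: int
  assumes "even m" and "m \<ge> 6"
  shows
    "(\<forall>v \<in> V m. length (route_E m v) = 3 \<and> distinct (route_E m v) \<and> set (route_E m v) = {0, 1, 2})
     \<and> (\<forall>c \<in> {0, 1, 2}. bij_betw (route_E_map m c) (V m) (V m))
     \<and> int (card (V m)) = m ^ 3
     \<and> (\<forall>c \<in> {0, 1, 2}. cyclic_on (route_E_map m c) (V m))
     \<and> arcs (D3 m) = (\<Union>c \<in> {0, 1, 2}. color_class m c)
     \<and> disjoint_family_on (color_class m) {0, 1, 2}
     \<and> (\<forall>c \<in> {0, 1, 2}. \<exists>p. directed_hamilton_cycle (D3 m) p \<and> set p = color_class m c)"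
proof (intro conjI)
  show "\<forall>v \<in> V m. length (route_E m v) = 3 \<and> distinct (route_E m v) \<and> set (route_E m v) = {0, 1, 2}"
    using route_E_permutation by blast
  show "\<forall>c \<in> {0, 1, 2}. bij_betw (route_E_map m c) (V m) (V m)"
    using bij_betw_route_E_map assms by blast
  show "int (card (V m)) = m ^ 3" using card_V assms by simp
  show cyclic: "\<forall>c \<in> {0, 1, 2}. cyclic_on (route_E_map m c) (V m)"
    using cyclic_on_route_E_map assms by blast
  show arcs: "arcs (D3 m) = (\<Union>c \<in> {0, 1, 2}. color_class m c)"
  proof -
    have "{0, 1, 2} = (\<lambda>c. route_E m v ! c) ` {0, 1, 2}" for v
    proof -
      have "{0, 1, 2 :: nat} = {..<3}" by auto
      moreover have "set (route_E m v) = (\<lambda>c. route_E m v ! c) ` {..<length (route_E m v)}"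
        by (auto simp: set_conv_nth)
      ultimately show ?thesis using route_E_permutation[of m v] by metis
    qed
    then have directions: "(\<exists>d \<in> {0, 1, 2}. P d) \<longleftrightarrow> (\<exists>c \<in> {0, 1, 2}. P (route_E m v ! c))" for P v
      by (metis (no_types, lifting) bex_imageD rev_image_eqI)
    have "arcs (D3 m) = {a. \<exists>v \<in> V m. \<exists>d \<in> {0, 1, 2}. a = (v, step m d v)}"
      unfolding D3_def pre_digraph.simps by blast
    also have "\<dots> = {a. \<exists>v \<in> V m. \<exists>c \<in> {0, 1, 2}. a = (v, route_E_map m c v)}"
      unfolding route_E_map_def by (rule Collect_cong, rule bex_cong[OF refl], rule directions)
    also have "\<dots> = (\<Union>c \<in> {0, 1, 2}. color_class m c)"
      unfolding color_class_def by blast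
    finally show ?thesis .
  qed
  show "disjoint_family_on (color_class m) {0, 1, 2}"
  proof (unfold disjoint_family_on_def, intro ballI impI equals0I)
    fix c c' a assume c: "c \<in> {0, 1, 2 :: nat}" "c' \<in> {0, 1, 2 :: nat}" "c \<noteq> c'"
      and "a \<in> color_class m c \<inter> color_class m c'"
    then obtain v where v: "v \<in> V m" "route_E_map m c v = route_E_map m c' v"
      by (auto simp: color_class_def)
    have lt: "c < 3" "c' < 3" using c by auto
    have "route_E m v ! c = route_E m v ! c'"
      using step_direction_inj[OF _ v(1) v(2)[unfolded route_E_map_def]] route_E_nth[OF lt(1)] route_E_nth[OF lt(2)] assms(2)
      by auto
    then show False using route_E_permutation[of m v] lt c(3) by (simp add: nth_eq_iff_index_eq)
  qed
  show "\<forall>c \<in> {0, 1, 2}. \<exists>p. directed_hamilton_cycle (D3 m) p \<and> set p = color_class m c"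
  proof
    fix c :: nat assume c: "c \<in> {0, 1, 2}"
    have class_eq: "color_class m c = (\<lambda>v. (v, route_E_map m c v)) ` verts (D3 m)"
      by (auto simp: color_class_def D3_def)
    show "\<exists>p. directed_hamilton_cycle (D3 m) p \<and> set p = color_class m c"
      unfolding class_eq
    proof (rule directed_hamilton_cycle_if_cyclic_on)
      show "(\<lambda>v. (v, route_E_map m c v)) ` verts (D3 m) \<subseteq> arcs (D3 m)"
        using c unfolding arcs class_eq[symmetric] by blast
    qed (use cyclic c finite_V inj_on_route_E_map assms in \<open>auto simp: D3_def\<close>)
  qed
qed

end
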